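(* The set of Legendre multiplier sequences is a strict subset of the set of Hermite multiplier sequences: every Legendre multiplier sequence is a Hermite multiplier sequence, and there exist Hermite multiplier sequences that are not Legendre multiplier sequences.
   Context: The Legendre polynomials $\mathfrak{Le}_n(x)$ are defined by $\frac{1}{\sqrt{1-2xt+t^2}}=\sum_{k=0}^{\infty}\mathfrak{Le}_k(x)t^k$, and the Hermite polynomials by $H_n(x)=(-1)^ne^{x^2}\frac{d^n}{dx^n}e^{-x^2}$. For a simple set of real polynomials $Q=\{q_k\}_{k=0}^\infty$ (i.e. $\deg q_k=k$), a real sequence $\{\gamma_k\}_{k=0}^{\infty}$ is a $Q$-multiplier sequence if the linear operator $T$ on $\mathbb{R}[x]$ defined by $T[q_k]=\gamma_k q_k$ maps every real polynomial having only real zeros to a polynomial having only real zeros. Legendre (resp. Hermite) multiplier sequences are the $Q$-multiplier sequences for $Q=\{\mathfrak{Le}_k\}$ (resp. $Q=\{H_k\}$). *)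

theory Defs
  imports "HOL-Analysis.Analysis" "HOL-Computational_Algebra.Polynomial"
begin

definition legendre_poly :: "nat \<Rightarrow> real poly" where
  "legendre_poly = (THE Q. \<forall>x::real. \<exists>r>0. \<forall>t::real. \<bar>t\<bar> < r \<longrightarrow>
       (\<lambda>k. poly (Q k) x * t ^ k) sums (1 / sqrt (1 - 2 * x * t + t ^ 2)))"

definition hermite_poly :: "nat \<Rightarrow> real poly" where
  "hermite_poly n = (THE p. \<forall>x::real.
       poly p x = (-1) ^ n * exp (x ^ 2) * (deriv ^^ n) (\<lambda>y. exp (- (y ^ 2))) x)"

text \<open>A real polynomial has only real zeros (the zero polynomial is counted as
  having only real zeros, following the usual convention).\<close>
definition only_real_zeros :: "real poly \<Rightarrow> bool" where
  "only_real_zeros p \<longleftrightarrow> p = 0 \<or>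
     (\<forall>z::complex. poly (map_poly complex_of_real p) z = 0 \<longrightarrow> Im z = 0)"

text \<open>Q-multiplier sequence for a simple set Q = {q_k}.  Since Q is a basis of R[x],
  every polynomial is uniquely a finite combination sum_{k\<le>n} c_k q_k, and the operator
  T with T[q_k] = gamma_k q_k sends it to sum_{k\<le>n} gamma_k c_k q_k.\<close>
definition Q_multiplier_sequence :: "(nat \<Rightarrow> real poly) \<Rightarrow> (nat \<Rightarrow> real) \<Rightarrow> bool" where
  "Q_multiplier_sequence Q \<gamma> \<longleftrightarrow>
     (\<forall>(c::nat \<Rightarrow> real) (n::nat).
        only_real_zeros (\<Sum>k\<le>n. smult (c k) (Q k)) \<longrightarrow>
        only_real_zeros (\<Sum>k\<le>n. smult (\<gamma> k * c k) (Q k)))"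

end

theory Submission
  imports Defs "HOL-Computational_Algebra.Fundamental_Theorem_Algebra"
begin

text \<open>Let \<open>D\<close> be the derivative and \<open>A p = x p - p'/2\<close>, so that \<open>A\<^sup>j D\<^sup>j\<close> acts on the Hermite
  polynomial \<open>H\<^sub>k\<close> as \<open>k(k-1)\<dots>(k-j+1)\<close>. If \<open>B = \<Sum> b\<^sub>j y\<^sup>j\<close> has only nonpositive zeros, then
  \<open>\<Sum> b\<^sub>j A\<^sup>j D\<^sup>j\<close> preserves nonvanishing on the upper half-plane; this follows one linear factor
  \<open>y + r\<close> at a time, because \<open>p/p'\<close> and \<open>A p/p\<close> map the upper half-plane into itself. By Newton's
  formula \<open>\<gamma>\<^sub>k = \<Sum> (k choose j) \<Delta>\<^sup>j\<gamma>\<^sub>0\<close>, a sequence is therefore a Hermite multiplier sequence as soon as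
  the Jensen polynomials of \<open>j \<mapsto> \<Delta>\<^sup>j\<gamma>\<^sub>0\<close> have only nonpositive zeros. Their zeros are real whenever those
  of the Jensen polynomials of \<open>\<gamma>\<close> are, the two being related by a real Moebius transformation.
  The differences are nonnegative if \<open>\<gamma>\<close> is nonnegative and nondecreasing: the discriminant of the cubic
  Jensen polynomials makes the defect \<open>1 - \<gamma>\<^sub>k\<gamma>\<^sub>k\<^sub>+\<^sub>2/\<gamma>\<^sub>k\<^sub>+\<^sub>1\<^sup>2\<close> either vanish identically or decay no
  faster than \<open>k\<^sup>-\<^sup>2\<close>, which keeps \<open>\<Delta>\<gamma>\<close> away from \<open>0\<close>, and a log-concave sequence that stays away
  from \<open>0\<close> is nondecreasing.

  A Legendre multiplier sequence is a classical one by a scaling limit, so up to signs it is nonnegative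
  and without gaps. The real-rooted polynomials \<open>x P\<^sub>n\<^sub>+\<^sub>1\<close>, a positive combination of
  \<open>P\<^sub>n\<^sub>+\<^sub>2\<close> and \<open>P\<^sub>n\<close>, and \<open>(x\<^sup>2 - s) P\<^sub>n\<^sub>+\<^sub>2\<close> force it to be nondecreasing or to have at most two
  (consecutive) nonzero terms. The sequence \<open>\<gamma>\<^sub>k = k\<close> separates the two classes.\<close>

section \<open>Polynomials without zeros in the upper half-plane\<close>

definition uhp_stable :: "complex poly \<Rightarrow> bool" where
  "uhp_stable p \<longleftrightarrow> (\<forall>z. Im z > 0 \<longrightarrow> poly p z \<noteq> 0)"

lemma uhp_stable_nonzero: "uhp_stable p \<Longrightarrow> p \<noteq> 0"
  unfolding uhp_stable_def by (metis poly_0 complex.sel(2) zero_less_one)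

lemma uhp_stable_mult_iff: "uhp_stable (p * q) \<longleftrightarrow> uhp_stable p \<and> uhp_stable q"
  by (auto simp: uhp_stable_def)

lemma uhp_stable_smult: "uhp_stable p \<Longrightarrow> c \<noteq> 0 \<Longrightarrow> uhp_stable (smult c p)"
  by (simp add: uhp_stable_def)

lemma uhp_stable_induct [consumes 1, case_names const factor]:
  assumes "uhp_stable p"
    and const: "\<And>c. c \<noteq> 0 \<Longrightarrow> P [:c:]"
    and factor: "\<And>r q. Im r \<le> 0 \<Longrightarrow> uhp_stable q \<Longrightarrow> P q \<Longrightarrow> P ([:-r, 1:] * q)"
  shows "P p"
  using assms(1)
proof (induction "degree p" arbitrary: p)
  case 0
  then obtain c where "p = [:c:]"
    by (metis degree_eq_zeroE)
  with 0 uhp_stable_nonzero const show ?case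
    by fastforce
next
  case (Suc n)
  then have "\<not> constant (poly p)"
    by (simp add: constant_degree)
  then obtain r where r: "poly p r = 0"
    using fundamental_theorem_of_algebra by blast
  then obtain q where q: "p = [:-r, 1:] * q"
    by (metis dvdE poly_eq_0_iff_dvd)
  have st: "uhp_stable q"
    using Suc.prems q uhp_stable_mult_iff by blast
  have "Im r \<le> 0"
    using r Suc.prems by (meson not_le uhp_stable_def)
  moreover have "degree p = Suc (degree q)"
    unfolding q using uhp_stable_nonzero[OF st]
    by (subst degree_mult_eq) auto
  then have "P q"
    using Suc.hyps st by simp
  ultimately show ?case
    unfolding q using factor st by blast
qed

lemma Im_inverse_diff_neg: "Im r \<le> 0 \<Longrightarrow> Im z > 0 \<Longrightarrow> Im (1 / (z - r)) < 0"
  by (simp add: Im_divide field_simps) (smt (verit) not_sum_power2_lt_zero zero_eq_power2 divide_neg_pos sum_power2_gt_zero_iff)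

text \<open>The logarithmic derivative is the sum of 1/(z - r) over the zeros r. None of them lies
  in the upper half-plane, so every summand has negative imaginary part, and the sum is empty only
  for constants.\<close>

lemma uhp_stable_log_deriv:
  assumes "uhp_stable p" "Im z > 0"
  shows "Im (poly (pderiv p) z / poly p z) \<le> 0"
    and "pderiv p \<noteq> 0 \<Longrightarrow> Im (poly (pderiv p) z / poly p z) < 0"
proof -
  have "Im (poly (pderiv p) z / poly p z) \<le> 0 \<and>
        (pderiv p \<noteq> 0 \<longrightarrow> Im (poly (pderiv p) z / poly p z) < 0)"
    using assms(1)
  proof (induction rule: uhp_stable_induct)
    case (const c)
    then show ?case by (simp add: pderiv_pCons)
  next
    case (factor r q)
    have q0: "poly q z \<noteq> 0"
      using factor assms(2) by (simp add: uhp_stable_def)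
    have zr: "z - r \<noteq> 0"
      using factor assms(2) by auto
    have "poly (pderiv ([:-r, 1:] * q)) z / poly ([:-r, 1:] * q) z
        = ((z - r) * poly (pderiv q) z + poly q z) / ((z - r) * poly q z)"
      unfolding pderiv_mult by (simp add: pderiv_pCons algebra_simps)
    also have "\<dots> = poly (pderiv q) z / poly q z + 1 / (z - r)"
      using q0 zr by (simp add: field_simps)
    finally have "Im (poly (pderiv ([:-r, 1:] * q)) z / poly ([:-r, 1:] * q) z) < 0"
      using factor Im_inverse_diff_neg[of r z] assms(2) by simp
    then show ?case by simp
  qed
  then show "Im (poly (pderiv p) z / poly p z) \<le> 0"
    and "pderiv p \<noteq> 0 \<Longrightarrow> Im (poly (pderiv p) z / poly p z) < 0"
    by auto
qed

lemma uhp_stable_pderiv: "uhp_stable p \<Longrightarrow> pderiv p \<noteq> 0 \<Longrightarrow> uhp_stable (pderiv p)"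
  unfolding uhp_stable_def[of "pderiv p"] using uhp_stable_log_deriv(2) by fastforce

lemma Im_divide_inverse: "Im (a / b) < 0 \<longleftrightarrow> Im (b / a) > 0"
proof -
  have "Im (1 / w) < 0 \<longleftrightarrow> Im w > 0" for w :: complex
    by (cases "w = 0") (auto simp: Im_divide complex_neq_0 zero_less_divide_iff)
  from this[of "b / a"] show ?thesis by simp
qed

text \<open>A zero z in the upper half-plane would give p(z)/p'(z) = w, although p/p' maps the upper
  half-plane into itself.\<close>

lemma uhp_stable_diff_pderiv:
  assumes "uhp_stable p" "Im w \<le> 0"
  shows "uhp_stable (p - smult w (pderiv p))"
proof (cases "pderiv p = 0")
  case True
  then show ?thesis using assms by simp
next
  case False
  show ?thesis
    unfolding uhp_stable_def
  proof (intro allI impI notI)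
    fix z assume z: "Im z > 0" and "poly (p - smult w (pderiv p)) z = 0"
    then have eq: "poly p z = w * poly (pderiv p) z"
      by simp
    have "Im (poly p z / poly (pderiv p) z) > 0"
      using uhp_stable_log_deriv(2)[OF assms(1) z False] Im_divide_inverse by blast
    moreover have "poly (pderiv p) z \<noteq> 0"
      using uhp_stable_pderiv[OF assms(1) False] z by (simp add: uhp_stable_def)
    ultimately show False
      using eq assms(2) by simp
  qed
qed

text \<open>The zeros of \<open>q\<close> are at distance at least \<open>Im z\<close> from \<open>z\<close>, hence their distance to \<open>a\<close>
  is at most a fixed multiple of their distance to \<open>z\<close>. This replaces Hurwitz' theorem.\<close>

lemma uhp_stable_lower_bound:
  assumes "uhp_stable q" "Im z > 0" "degree q \<le> n"
  shows "cmod (poly q a) \<le> (1 + cmod (a - z) / Im z) ^ n * cmod (poly q z)"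
  using assms(1,3)
proof (induction arbitrary: n rule: uhp_stable_induct)
  case (const c)
  have "1 \<le> (1 + cmod (a - z) / Im z) ^ n"
    using assms(2) by (intro one_le_power) simp
  then show ?case
    by (simp add: mult_le_cancel_right1)
next
  case (factor r q)
  let ?K = "1 + cmod (a - z) / Im z"
  have "degree ([:-r, 1:] * q) = Suc (degree q)"
    using uhp_stable_nonzero[OF \<open>uhp_stable q\<close>] by (subst degree_mult_eq) auto
  then obtain m where m: "n = Suc m" "degree q \<le> m"
    using factor.prems by (cases n) auto
  have "Im z \<le> cmod (z - r)"
    using factor(1) abs_Im_le_cmod[of "z - r"] by simp
  then have "cmod (a - z) \<le> cmod (a - z) / Im z * cmod (z - r)"
    using assms(2) by (simp add: field_simps) (metis mult.commute mult_right_mono norm_ge_zero)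
  then have "cmod (a - r) \<le> ?K * cmod (z - r)"
    using norm_triangle_ineq[of "a - z" "z - r"] by (simp add: algebra_simps)
  then have "cmod (a - r) * cmod (poly q a) \<le> (?K * cmod (z - r)) * (?K ^ m * cmod (poly q z))"
    using factor.IH[OF m(2)] assms(2) by (intro mult_mono) auto
  moreover have "poly ([:-r, 1:] * q) x = (x - r) * poly q x" for x
    by (simp add: algebra_simps)
  ultimately show ?case
    by (simp only: m norm_mult power_Suc mult_ac)
qed

section \<open>Real polynomials with only real zeros\<close>

abbreviation cpoly :: "real poly \<Rightarrow> complex poly" where
  "cpoly \<equiv> map_poly complex_of_real"

lemma cpoly_add: "cpoly (p + q) = cpoly p + cpoly q"
  by (rule poly_eqI) (simp add: coeff_map_poly)

lemma cpoly_sum: "cpoly (sum f A) = (\<Sum>x\<in>A. cpoly (f x))"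
  by (induction A rule: infinite_finite_induct) (simp_all add: cpoly_add)

lemma cpoly_diff: "cpoly (p - q) = cpoly p - cpoly q"
  by (rule poly_eqI) (simp add: coeff_map_poly)

lemma cpoly_smult: "cpoly (smult c p) = smult (complex_of_real c) (cpoly p)"
  by (rule poly_eqI) (simp add: coeff_map_poly)

lemma cpoly_mult: "cpoly (p * q) = cpoly p * cpoly q"
  by (rule poly_eqI) (simp add: coeff_map_poly coeff_mult)

lemma cpoly_pderiv: "cpoly (pderiv p) = pderiv (cpoly p)"
  by (rule poly_eqI) (simp add: coeff_map_poly coeff_pderiv)

lemma cpoly_pcompose: "cpoly (pcompose p q) = pcompose (cpoly p) (cpoly q)"
  by (induction p) (simp_all add: pcompose_pCons map_poly_pCons cpoly_add cpoly_mult)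

lemma cpoly_eq_0_iff: "cpoly p = 0 \<longleftrightarrow> p = 0"
  by (simp add: map_poly_eq_0_iff)

lemma poly_cpoly_of_real: "poly (cpoly p) (complex_of_real x) = complex_of_real (poly p x)"
  by (induction p) (simp_all add: map_poly_pCons)

lemma poly_cpoly_cnj: "poly (cpoly p) (cnj z) = cnj (poly (cpoly p) z)"
  by (induction p) (simp_all add: map_poly_pCons)

text \<open>Nonreal zeros of a real polynomial come in conjugate pairs, so the upper half-plane
  alone decides. The zero polynomial is listed separately because it is not stable.\<close>

lemma only_real_zeros_iff_stable: "only_real_zeros p \<longleftrightarrow> p = 0 \<or> uhp_stable (cpoly p)"
proof -
  have "Im z = 0" if st: "uhp_stable (cpoly p)" and z: "poly (cpoly p) z = 0" for z
  proof (rule ccontr)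
    assume "Im z \<noteq> 0"
    moreover have "poly (cpoly p) (cnj z) = 0"
      using z by (simp add: poly_cpoly_cnj)
    ultimately show False
      using st z by (cases "Im z > 0") (auto simp: uhp_stable_def)
  qed
  then show ?thesis
    by (auto simp: only_real_zeros_def uhp_stable_def)
qed

lemma only_real_zeros_0 [simp]: "only_real_zeros 0"
  by (simp add: only_real_zeros_def)

lemma only_real_zeros_smult: "only_real_zeros p \<Longrightarrow> only_real_zeros (smult c p)"
  by (auto simp: only_real_zeros_def cpoly_smult)

lemma only_real_zeros_mult:
  "p * q \<noteq> 0 \<Longrightarrow> only_real_zeros (p * q) \<longleftrightarrow> only_real_zeros p \<and> only_real_zeros q"
  by (auto simp: only_real_zeros_def cpoly_mult)

lemma only_real_zeros_times: "only_real_zeros p \<Longrightarrow> only_real_zeros q \<Longrightarrow> only_real_zeros (p * q)"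
  by (auto simp: only_real_zeros_def cpoly_mult)

lemma only_real_zeros_linear [simp]: "only_real_zeros [:a, b:]"
proof -
  have "Im z = 0 \<or> a = 0 \<and> b = 0" if "complex_of_real a + z * complex_of_real b = 0" for z
    using that by (auto simp: complex_eq_iff)
  then show ?thesis
    by (auto simp: only_real_zeros_def map_poly_pCons)
qed

lemma only_real_zeros_power: "only_real_zeros p \<Longrightarrow> only_real_zeros (p ^ n)"
proof (induction n)
  case 0
  then show ?case using only_real_zeros_linear[of 1 0] by (simp add: one_pCons)
qed (simp add: only_real_zeros_times)

lemma only_real_zeros_pderiv: "only_real_zeros p \<Longrightarrow> only_real_zeros (pderiv p)"
  unfolding only_real_zeros_iff_stable
  using uhp_stable_pderiv by (auto simp: cpoly_pderiv simp flip: cpoly_eq_0_iff)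

lemma only_real_zeros_pcompose_linear:
  assumes "only_real_zeros p" "b \<noteq> 0"
  shows "only_real_zeros (pcompose p [:a, b:])"
proof -
  have "Im z = 0" if "Im (complex_of_real a + z * complex_of_real b) = 0" for z
    using that assms(2) by auto
  with assms show ?thesis
    by (auto simp: only_real_zeros_def cpoly_pcompose map_poly_pCons poly_pcompose)
qed

text \<open>The constant in \<open>uhp_stable_lower_bound\<close> depends only on a, z and the
  degree bound, so the estimate survives the limit. A zero z of q in the upper half-plane would then
  force q to vanish at the real point a, which was chosen not to be a zero.\<close>

lemma only_real_zeros_limit:
  assumes real: "eventually (\<lambda>i. only_real_zeros (p i)) F"
    and deg: "\<And>i. degree (p i) \<le> n" "degree q \<le> n"
    and lim: "\<And>k. ((\<lambda>i. coeff (p i) k) \<longlongrightarrow> coeff q k) F"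
    and F: "F \<noteq> bot"
  shows "only_real_zeros q"
proof (cases "q = 0")
  case False
  obtain a where a: "poly q a \<noteq> 0"
    using False poly_all_0_iff_0 by blast
  have conv: "((\<lambda>i. poly (cpoly (p i)) z) \<longlongrightarrow> poly (cpoly q) z) F" for z
  proof -
    have eq: "poly (cpoly r) z = (\<Sum>k\<le>n. complex_of_real (coeff r k) * z ^ k)" if "degree r \<le> n" for r
    proof -
      have "poly (cpoly r) z = (\<Sum>k\<le>degree r. complex_of_real (coeff r k) * z ^ k)"
        by (simp add: poly_altdef degree_map_poly coeff_map_poly)
      also have "\<dots> = (\<Sum>k\<le>n. complex_of_real (coeff r k) * z ^ k)"
        using that by (intro sum.mono_neutral_left) (auto simp: coeff_eq_0)
      finally show ?thesis .
    qed
    show ?thesis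
      unfolding eq[OF deg(1)] eq[OF deg(2)] by (intro tendsto_intros lim)
  qed
  have "uhp_stable (cpoly q)"
    unfolding uhp_stable_def
  proof (intro allI impI notI)
    fix z assume z: "Im z > 0" and zero: "poly (cpoly q) z = 0"
    let ?K = "(1 + cmod (complex_of_real a - z) / Im z) ^ n"
    have "eventually (\<lambda>i. cmod (poly (cpoly (p i)) (complex_of_real a)) \<le> ?K * cmod (poly (cpoly (p i)) z)) F"
      using real
    proof eventually_elim
      case (elim i)
      show ?case
      proof (cases "p i = 0")
        case False
        with elim have "uhp_stable (cpoly (p i))"
          by (simp add: only_real_zeros_iff_stable)
        from uhp_stable_lower_bound[OF this z, of n] show ?thesis
          using deg(1)[of i] by (simp add: degree_map_poly)
      qed simp
    qed
    then have "cmod (poly (cpoly q) (complex_of_real a)) \<le> ?K * cmod (poly (cpoly q) z)"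
      by (rule tendsto_le[OF F tendsto_mult[OF tendsto_const tendsto_norm[OF conv]] tendsto_norm[OF conv]])
    with zero a show False
      by (simp add: poly_cpoly_of_real)
  qed
  then show ?thesis
    by (simp add: only_real_zeros_iff_stable)
qed simp

lemma only_real_zeros_induct [consumes 2, case_names const factor]:
  assumes "only_real_zeros p" "p \<noteq> 0"
    and const: "\<And>c. c \<noteq> 0 \<Longrightarrow> P [:c:]"
    and factor: "\<And>r q. q \<noteq> 0 \<Longrightarrow> only_real_zeros q \<Longrightarrow> P q \<Longrightarrow> P ([:-r, 1:] * q)"
  shows "P p"
  using assms(1,2)
proof (induction "degree p" arbitrary: p)
  case 0
  then obtain c where "p = [:c:]"
    by (metis degree_eq_zeroE)
  with 0 const show ?case by auto
next
  case (Suc n)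
  then have "\<not> constant (poly (cpoly p))"
    by (simp add: constant_degree degree_map_poly)
  then obtain z where z: "poly (cpoly p) z = 0"
    using fundamental_theorem_of_algebra by blast
  with Suc.prems have "Im z = 0"
    by (auto simp: only_real_zeros_def)
  then have "z = complex_of_real (Re z)"
    by (simp add: complex_eq_iff)
  with z have "poly p (Re z) = 0"
    by (metis poly_cpoly_of_real of_real_eq_0_iff)
  then obtain q where q: "p = [:- Re z, 1:] * q"
    by (metis dvdE poly_eq_0_iff_dvd)
  have "q \<noteq> 0" "only_real_zeros q"
    using Suc.prems only_real_zeros_mult[of "[:- Re z, 1:]" q] unfolding q by auto
  moreover from this have "degree p = Suc (degree q)"
    unfolding q by (subst degree_mult_eq) auto
  ultimately have "P q"
    using Suc.hyps by simp
  with \<open>q \<noteq> 0\<close> \<open>only_real_zeros q\<close> show ?case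
    unfolding q by (rule factor)
qed

lemma only_real_zeros_factorization:
  assumes "only_real_zeros p" "p \<noteq> 0"
  obtains c rs where "c \<noteq> 0" "p = smult c (\<Prod>r\<leftarrow>rs. [:-r, 1:])"
proof -
  have "\<exists>c rs. c \<noteq> 0 \<and> p = smult c (\<Prod>r\<leftarrow>rs. [:-r, 1:])"
    using assms
  proof (induction rule: only_real_zeros_induct)
    case (const c)
    then show ?case by (intro exI[of _ c] exI[of _ "[]"]) simp
  next
    case (factor r q)
    then obtain c rs where "c \<noteq> 0" "q = smult c (\<Prod>r\<leftarrow>rs. [:-r, 1:])"
      by blast
    then show ?case
      by (intro exI[of _ c] exI[of _ "r # rs"]) simp
  qed
  with that show ?thesis by blast
qed

text \<open>If \<open>coeff p (n + 2)\<close> is the leading coefficient, the difference of the two sides is its square times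
  the sum of the squares of the zeros.\<close>

lemma only_real_zeros_top_coeffs:
  assumes "only_real_zeros p" "degree p \<le> n + 2"
  shows "2 * coeff p (n + 2) * coeff p n \<le> (coeff p (n + 1))\<^sup>2"
proof (cases "p = 0")
  case False
  show ?thesis
    using assms(1) False assms(2)
  proof (induction arbitrary: n rule: only_real_zeros_induct)
    case (const c)
    then show ?case by (simp add: coeff_pCons split: nat.splits)
  next
    case (factor r q)
    have dq: "degree q \<le> n + 1"
      using factor by (subst (asm) degree_mult_eq) auto
    have c: "coeff ([:-r, 1:] * q) k = (case k of 0 \<Rightarrow> 0 | Suc j \<Rightarrow> coeff q j) - r * coeff q k" for k
      by (simp add: coeff_pCons split: nat.splits)
    show ?case
    proof (cases n)
      case 0
      have "coeff q 2 = 0"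
        using dq 0 by (intro coeff_eq_0) simp
      then show ?thesis
        using 0 zero_le_square[of "coeff q 0"] zero_le_square[of "r * coeff q 1"]
        unfolding c by (simp add: numeral_2_eq_2 power2_eq_square algebra_simps)
    next
      case (Suc m)
      have "coeff q (n + 2) = 0"
        using dq by (intro coeff_eq_0) simp
      moreover have "2 * coeff q (m + 2) * coeff q m \<le> (coeff q (m + 1))\<^sup>2"
        using factor.IH[of m] dq Suc by simp
      moreover have "0 \<le> (r * coeff q (m + 2))\<^sup>2"
        by simp
      ultimately show ?thesis
        using Suc unfolding c by (simp add: numeral_2_eq_2 power2_eq_square algebra_simps)
    qed
  qed
qed simp

text \<open>The difference of the two sides is \<open>(coeff p 0)^2\<close> times the sum of the
  squared reciprocals of the zeros, hence positive as soon as there is a zero.\<close>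

lemma only_real_zeros_bottom_coeffs:
  assumes "only_real_zeros p" "coeff p 0 \<noteq> 0"
  shows "2 * coeff p 0 * coeff p 2 \<le> (coeff p 1)\<^sup>2"
    and "degree p \<noteq> 0 \<Longrightarrow> 2 * coeff p 0 * coeff p 2 < (coeff p 1)\<^sup>2"
proof -
  have "p \<noteq> 0" using assms by auto
  have "2 * coeff p 0 * coeff p 2 \<le> (coeff p 1)\<^sup>2 \<and>
     (degree p \<noteq> 0 \<longrightarrow> 2 * coeff p 0 * coeff p 2 < (coeff p 1)\<^sup>2)"
    using assms(1) \<open>p \<noteq> 0\<close> assms(2)
  proof (induction rule: only_real_zeros_induct)
    case (const c)
    then show ?case by (simp add: coeff_pCons numeral_2_eq_2)
  next
    case (factor r q)
    have c: "coeff ([:-r, 1:] * q) k = (case k of 0 \<Rightarrow> 0 | Suc j \<Rightarrow> coeff q j) - r * coeff q k" for k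
      by (simp add: coeff_pCons split: nat.splits)
    have q0: "coeff q 0 \<noteq> 0"
      using factor.prems by (auto simp: c)
    have "(r * coeff q 1)\<^sup>2 \<ge> r\<^sup>2 * (2 * coeff q 0 * coeff q 2)"
      unfolding power_mult_distrib using factor.IH[OF q0] by (intro mult_left_mono) auto
    moreover have "(coeff q 0)\<^sup>2 > 0"
      using q0 by simp
    ultimately have "2 * coeff ([:-r, 1:] * q) 0 * coeff ([:-r, 1:] * q) 2 < (coeff ([:-r, 1:] * q) 1)\<^sup>2"
      unfolding c by (simp add: numeral_2_eq_2 power2_eq_square algebra_simps)
    then show ?case by simp
  qed
  then show "2 * coeff p 0 * coeff p 2 \<le> (coeff p 1)\<^sup>2"
    and "degree p \<noteq> 0 \<Longrightarrow> 2 * coeff p 0 * coeff p 2 < (coeff p 1)\<^sup>2"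
    by auto
qed

lemma degree_prod_list_linear: "degree (\<Prod>r\<leftarrow>rs. [:-r, 1::real:]) = length rs"
proof (induction rs)
  case (Cons r rs)
  have "(\<Prod>r\<leftarrow>rs. [:-r, 1::real:]) \<noteq> 0"
    by (auto simp: prod_list_zero_iff)
  then show ?case
    using Cons by (simp del: mult_pCons_left add: degree_mult_eq)
qed simp

lemma only_real_zeros_quadratic:
  assumes "only_real_zeros [:a, 2 * b, c:]"
  shows "a * c \<le> b\<^sup>2"
proof (cases "c = 0")
  case False
  then obtain l rs where l: "l \<noteq> 0" and rs: "[:a, 2 * b, c:] = smult l (\<Prod>r\<leftarrow>rs. [:-r, 1:])"
    using only_real_zeros_factorization[OF assms] by auto
  have "length rs = 2"
    using arg_cong[OF rs, of degree] False l by (simp add: degree_prod_list_linear)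
  then obtain x y where "rs = [x, y]"
    by (auto simp: numeral_2_eq_2 length_Suc_conv)
  with rs have *: "a = l * (x * y)" "2 * b = l * (- x - y)" "c = l"
    by auto
  have "4 * (b\<^sup>2 - a * c) = (2 * b)\<^sup>2 - 4 * a * c"
    by (simp add: power2_eq_square)
  also have "\<dots> = l\<^sup>2 * (x - y)\<^sup>2"
    unfolding * by (simp add: power2_eq_square algebra_simps)
  also have "\<dots> \<ge> 0"
    by simp
  finally show ?thesis by simp
qed simp

text \<open>The discriminant of a cubic with real zeros is nonnegative.\<close>

lemma only_real_zeros_cubic:
  assumes "only_real_zeros [:a, 3 * b, 3 * c, d:]" "d \<noteq> 0"
  shows "(b * c - a * d)\<^sup>2 \<le> 4 * (b\<^sup>2 - a * c) * (c\<^sup>2 - b * d)"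
proof -
  obtain l rs where l: "l \<noteq> 0" and rs: "[:a, 3 * b, 3 * c, d:] = smult l (\<Prod>r\<leftarrow>rs. [:-r, 1:])"
    using only_real_zeros_factorization[OF assms(1)] assms(2) by auto
  have "length rs = 3"
    using arg_cong[OF rs, of degree] assms(2) l by (simp add: degree_prod_list_linear)
  then obtain x y z where "rs = [x, y, z]"
    by (auto simp: numeral_3_eq_3 length_Suc_conv)
  with rs have *: "a = - l * (x * y * z)" "b = l * (x * y + y * z + z * x) / 3"
      "c = - l * (x + y + z) / 3" "d = l"
    by (auto simp: algebra_simps)
  have "4 * (b\<^sup>2 - a * c) * (c\<^sup>2 - b * d) - (b * c - a * d)\<^sup>2
      = (l\<^sup>2 * (x - y) * (y - z) * (z - x))\<^sup>2 / 27"
    unfolding * by (simp add: field_simps power2_eq_square) 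
  also have "\<dots> \<ge> 0"
    by simp
  finally show ?thesis by simp
qed

section \<open>Hermite polynomials\<close>

primrec hermite :: "nat \<Rightarrow> real poly" where
  "hermite 0 = 1"
| "hermite (Suc n) = [:0, 2:] * hermite n - pderiv (hermite n)"

lemma deriv_gauss:
  "(deriv ^^ n) (\<lambda>y. exp (- (y\<^sup>2))) = (\<lambda>x::real. (-1) ^ n * poly (hermite n) x * exp (- (x\<^sup>2)))"
proof (induction n)
  case (Suc n)
  have "((\<lambda>x. (-1) ^ n * poly (hermite n) x * exp (- (x\<^sup>2))) has_real_derivative
      (-1) ^ Suc n * poly (hermite (Suc n)) x * exp (- (x\<^sup>2))) (at x)" for x
    by (auto intro!: derivative_eq_intros simp: algebra_simps)
  with Suc show ?case
    by (auto simp: DERIV_imp_deriv)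
qed simp

lemma hermite_poly_eq: "hermite_poly = hermite"
proof
  fix n
  have *: "(-1) ^ n * exp (x\<^sup>2) * (deriv ^^ n) (\<lambda>y. exp (- (y\<^sup>2))) x = poly (hermite n) x" for x :: real
    unfolding deriv_gauss by (simp add: exp_minus field_simps flip: power_mult_distrib)
  show "hermite_poly n = hermite n"
    unfolding hermite_poly_def *
    by (rule the_equality) (auto simp: poly_eq_poly_eq_iff[symmetric])
qed

lemma pderiv_hermite: "pderiv (hermite n) = smult (2 * real n) (hermite (n - 1))"
proof (induction n)
  case (Suc n)
  have "pderiv (hermite (Suc n)) = smult 2 (hermite n) + ([:0, 2:] * pderiv (hermite n) - pderiv (pderiv (hermite n)))"
    unfolding hermite.simps pderiv_diff pderiv_mult by (simp add: pderiv_pCons)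
  also have "[:0, 2:] * pderiv (hermite n) - pderiv (pderiv (hermite n))
      = smult (2 * real n) ([:0, 2:] * hermite (n - 1) - pderiv (hermite (n - 1)))"
    unfolding Suc pderiv_smult by (simp only: smult_diff_right mult_smult_right)
  also have "\<dots> = smult (2 * real n) (hermite n)"
    by (cases n) simp_all
  finally show ?case
    by (simp add: smult_add_left[symmetric] del: hermite.simps)
qed (simp add: pderiv_1)

lemma degree_hermite_le: "degree (hermite n) \<le> n"
proof (induction n)
  case (Suc n)
  have "degree ([:0, 2:] * hermite n) \<le> Suc n"
    using degree_mult_le[of "[:0, 2:]" "hermite n"] Suc by simp
  moreover have "degree (pderiv (hermite n)) \<le> Suc n"
    using Suc by (simp add: degree_pderiv)
  ultimately show ?case
    unfolding hermite.simps by (rule degree_diff_le)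
qed simp

text \<open>Parity allows a factor (-1)^k in a multiplier sequence to be absorbed by the
  substitution x -> -x.\<close>

lemma hermite_reflect: "pcompose (hermite n) [:0, -1:] = smult ((-1) ^ n) (hermite n)"
proof (induction n)
  case (Suc n)
  have "pcompose (pderiv p) [:0, -1:] = - pderiv (pcompose p [:0, -1:])" for p :: "real poly"
    by (simp add: pderiv_pcompose pderiv_pCons)
  then have "pcompose (hermite (Suc n)) [:0, -1:]
      = - ([:0, 2:] * pcompose (hermite n) [:0, -1:] - pderiv (pcompose (hermite n) [:0, -1:]))"
    by (simp add: pcompose_diff pcompose_mult pcompose_pCons pcompose_smult)
  also have "\<dots> = smult ((-1) ^ Suc n) (hermite (Suc n))"
    unfolding Suc by (simp add: pderiv_smult smult_diff_right)
  finally show ?case .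
qed (simp add: pcompose_1)

section \<open>Creation operator and stability-preserving operators diagonal on the Hermite
  polynomials\<close>

definition creation :: "complex poly \<Rightarrow> complex poly" where
  "creation p = [:0, 1:] * p - smult (1 / 2) (pderiv p)"

lemma creation_linear: "creation (p + smult w q) = creation p + smult w (creation q)"
  by (simp add: creation_def pderiv_add pderiv_smult algebra_simps smult_add_right smult_diff_right)

lemma creation_0 [simp]: "creation 0 = 0"
  by (simp add: creation_def)

lemma creation_smult: "creation (smult w q) = smult w (creation q)"
  using creation_linear[of 0 w q] by simp

text \<open>The quotient equals z - (p'/p)/2, and p'/p has nonpositive imaginary part.\<close>

lemma Im_creation_quotient:
  assumes "uhp_stable p" "Im z > 0"
  shows "Im (poly (creation p) z / poly p z) > 0"
proof -
  have "poly p z \<noteq> 0"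
    using assms by (simp add: uhp_stable_def)
  then have "poly (creation p) z / poly p z = z - (poly (pderiv p) z / poly p z) / 2"
    by (simp add: creation_def field_simps)
  moreover have "Im (z - w / 2) = Im z - Im w / 2" for w
    by simp
  ultimately show ?thesis
    using uhp_stable_log_deriv(1)[OF assms] assms(2) by (simp only:)
qed

lemma uhp_stable_creation: "uhp_stable p \<Longrightarrow> uhp_stable (creation p)"
  unfolding uhp_stable_def[of "creation p"] using Im_creation_quotient by fastforce

text \<open>Since the derivative of H_k is 2k H_(k-1), the factor 1/2 makes derivative followed by
  \<open>creation\<close> act on H_k as multiplication by k.\<close>

lemma creation_hermite: "creation (cpoly (hermite n)) = smult (1 / 2) (cpoly (hermite (Suc n)))"
  by (simp add: creation_def cpoly_diff cpoly_smult cpoly_pderiv smult_diff_right map_poly_pCons del: mult_pCons_right)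

lemma uhp_stable_hermite: "uhp_stable (cpoly (hermite n))"
proof (induction n)
  case 0
  show ?case by (simp add: uhp_stable_def)
next
  case (Suc n)
  have "cpoly (hermite (Suc n)) = smult 2 (creation (cpoly (hermite n)))"
    by (simp add: creation_hermite del: hermite.simps)
  with uhp_stable_smult[OF uhp_stable_creation[OF Suc], of 2] show ?case
    by simp
qed

text \<open>For \<open>B(y) = \<Prod>(y + r)\<close> this is the operator \<open>\<Sum> b\<^sub>j A\<^sup>j D\<^sup>j\<close>, where \<open>b\<^sub>j\<close> are the
  coefficients of \<open>B\<close>, \<open>A\<close> is the creation operator and \<open>D\<close> the derivative.\<close>

primrec normal_op :: "real list \<Rightarrow> complex poly \<Rightarrow> complex poly" where
  "normal_op [] p = p"
| "normal_op (r # rs) p = smult (complex_of_real r) (normal_op rs p) + creation (normal_op rs (pderiv p))"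

lemma normal_op_linear: "normal_op rs (p + smult w q) = normal_op rs p + smult w (normal_op rs q)"
proof (induction rs arbitrary: p q)
  case (Cons r rs)
  show ?case
    by (simp add: pderiv_add pderiv_smult Cons creation_linear smult_add_right algebra_simps)
qed simp

lemma normal_op_0 [simp]: "normal_op rs 0 = 0"
  by (induction rs) simp_all

lemma normal_op_smult: "normal_op rs (smult w q) = smult w (normal_op rs q)"
  using normal_op_linear[of rs 0 w q] by simp

lemma normal_op_sum: "normal_op rs (\<Sum>x\<in>X. f x) = (\<Sum>x\<in>X. normal_op rs (f x))"
proof (induction X rule: infinite_finite_induct)
  case (insert x X)
  then show ?case using normal_op_linear[of rs "f x" 1] by simp
qed simp_all

text \<open>With \<open>g\<close>, \<open>h\<close> the images of \<open>p\<close>, \<open>p'\<close>, stability of the images of all \<open>p - w p'\<close> with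
  \<open>Im w \<le> 0\<close> says that \<open>g / h\<close> maps the upper half-plane into itself.\<close>

lemma uhp_stable_normal_op:
  assumes "\<forall>r\<in>set rs. r > 0" "uhp_stable p"
  shows "uhp_stable (normal_op rs p)"
  using assms
proof (induction rs arbitrary: p)
  case (Cons r rs)
  have r: "r > 0" and IH: "\<And>q. uhp_stable q \<Longrightarrow> uhp_stable (normal_op rs q)"
    using Cons by auto
  show ?case
  proof (cases "pderiv p = 0")
    case True
    then show ?thesis
      using r IH[OF Cons.prems(2)] by (simp add: uhp_stable_smult)
  next
    case False
    define g where "g = normal_op rs p"
    define h where "h = normal_op rs (pderiv p)"
    have h: "uhp_stable h"
      unfolding h_def using IH uhp_stable_pderiv[OF Cons.prems(2) False] .
    show ?thesis
      unfolding uhp_stable_def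
    proof (intro allI impI notI)
      fix z assume z: "Im z > 0" and zero: "poly (normal_op (r # rs) p) z = 0"
      have h0: "poly h z \<noteq> 0"
        using h z by (simp add: uhp_stable_def)
      have "Im (poly g z / poly h z) > 0"
      proof (rule ccontr)
        define w where "w = poly g z / poly h z"
        assume "\<not> 0 < Im (poly g z / poly h z)"
        then have "uhp_stable (normal_op rs (p - smult w (pderiv p)))"
          by (intro IH uhp_stable_diff_pderiv Cons.prems) (simp add: w_def)
        moreover have "normal_op rs (p - smult w (pderiv p)) = g - smult w h"
          using normal_op_linear[of rs p "-w" "pderiv p"] by (simp add: g_def h_def)
        ultimately have "poly g z - w * poly h z \<noteq> 0"
          using z by (simp add: uhp_stable_def)
        then show False
          using h0 by (simp add: w_def)
      qed
      \<comment> \<open>Divided by \<open>h\<close>, the image of \<open>p\<close> splits into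
        \<open>r\<close> times \<open>g / h\<close> plus \<open>creation h / h\<close>; both terms
        have positive imaginary part.\<close>
      then have "Im (complex_of_real r * (poly g z / poly h z) + poly (creation h) z / poly h z) > 0"
        using add_pos_pos[OF mult_pos_pos[OF r] Im_creation_quotient[OF h z]]
        by (simp only: plus_complex.sel times_complex.sel Re_complex_of_real Im_complex_of_real) simp
      also have "complex_of_real r * (poly g z / poly h z) + poly (creation h) z / poly h z
          = poly (normal_op (r # rs) p) z / poly h z"
        by (simp add: g_def h_def add_divide_distrib)
      finally show False
        using zero by simp
    qed
  qed
qed simp

text \<open>A factor y contributes one derivative before and one \<open>creation\<close> after the
  remaining operator. Only the derivative can produce the zero polynomial.\<close>

lemma stable_or_0_normal_op_zeros:
  assumes "\<forall>r\<in>set rs. r > 0" "p = 0 \<or> uhp_stable p"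
  shows "normal_op (replicate m 0 @ rs) p = 0 \<or> uhp_stable (normal_op (replicate m 0 @ rs) p)"
  using assms(2)
proof (induction m arbitrary: p)
  case 0
  then show ?case using uhp_stable_normal_op[OF assms(1)] by auto
next
  case (Suc m)
  have "pderiv p = 0 \<or> uhp_stable (pderiv p)"
    using Suc.prems uhp_stable_pderiv by auto
  from Suc.IH[OF this] show ?case
    using uhp_stable_creation by auto
qed

text \<open>\<open>fact j * (k choose j)\<close> is the falling factorial k(k-1)...(k-j+1), so this
  is the eigenvalue on H_k of the operator that replaces y^j by A^j D^j.\<close>

definition factorial_eval :: "real poly \<Rightarrow> nat \<Rightarrow> real" where
  "factorial_eval p k = (\<Sum>j\<le>k. coeff p j * (fact j * real (k choose j)))"

lemma factorial_eval_smult: "factorial_eval (smult c p) k = c * factorial_eval p k"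
  by (simp add: factorial_eval_def sum_distrib_left mult.assoc)

text \<open>The falling factorial of k of length j+1 is k times that of k-1 of length j. At k = 0
  the truncated argument \<open>k - 1\<close> is harmless because of the factor k.\<close>

lemma factorial_eval_factor:
  "factorial_eval ([:r, 1:] * p) k = r * factorial_eval p k + real k * factorial_eval p (k - 1)"
proof (cases k)
  case 0
  then show ?thesis by (simp add: factorial_eval_def)
next
  case (Suc m)
  have "factorial_eval ([:r, 1:] * p) k
      = r * factorial_eval p k + (\<Sum>j\<le>k. (case j of 0 \<Rightarrow> 0 | Suc i \<Rightarrow> coeff p i) * (fact j * real (k choose j)))"
    by (simp add: factorial_eval_def coeff_pCons sum_distrib_left algebra_simps flip: sum.distrib)
  also have "(\<Sum>j\<le>k. (case j of 0 \<Rightarrow> 0 | Suc i \<Rightarrow> coeff p i) * (fact j * real (k choose j)))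
      = (\<Sum>j\<le>m. coeff p j * (fact (Suc j) * real (Suc m choose Suc j)))"
    unfolding Suc by (subst sum.atMost_Suc_shift) simp
  also have "\<dots> = real k * factorial_eval p (k - 1)"
    unfolding factorial_eval_def sum_distrib_left Suc diff_Suc_1
  proof (intro sum.cong refl)
    fix j
    have "real (Suc j) * real (Suc m choose Suc j) = real (Suc m) * real (m choose j)"
      unfolding of_nat_mult[symmetric] Suc_times_binomial by simp
    then show "coeff p j * (fact (Suc j) * real (Suc m choose Suc j))
        = real (Suc m) * (coeff p j * (fact j * real (m choose j)))"
      by (simp add: mult.assoc mult.left_commute del: binomial_Suc_Suc of_nat_Suc)
  qed
  finally show ?thesis .
qed

lemma normal_op_hermite:
  "normal_op rs (cpoly (hermite k))
    = smult (complex_of_real (factorial_eval (\<Prod>r\<leftarrow>rs. [:r, 1:]) k)) (cpoly (hermite k))"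
proof (induction rs arbitrary: k)
  case Nil
  show ?case by (cases k) (simp_all add: factorial_eval_def coeff_1)
next
  case (Cons r rs)
  let ?e = "factorial_eval (\<Prod>r\<leftarrow>rs. [:r, 1:])"
  have "creation (normal_op rs (pderiv (cpoly (hermite k))))
      = smult (complex_of_real (real k * ?e (k - 1))) (cpoly (hermite k))"
  proof (cases k)
    case (Suc m)
    then show ?thesis
      by (simp add: pderiv_hermite cpoly_smult normal_op_smult Cons creation_smult creation_hermite
          del: hermite.simps flip: cpoly_pderiv)
        (rule arg_cong[where f = "\<lambda>c. smult c (cpoly (hermite (Suc m)))"], simp add: field_simps)
  qed (simp add: pderiv_1)
  then show ?case
    by (simp add: Cons factorial_eval_factor smult_add_left del: mult_pCons_left)
qed

text \<open>A nonzero polynomial with nonnegative coefficients has no positive zeros, so B is a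
  constant times a power of y times factors y + u with u > 0. These are exactly the operators
  treated above.\<close>

lemma only_real_zeros_hermite_factorial_eval:
  assumes real: "only_real_zeros (\<Sum>k\<le>n. smult (c k) (hermite k))"
    and B: "only_real_zeros B" "\<And>j. coeff B j \<ge> 0"
  shows "only_real_zeros (\<Sum>k\<le>n. smult (factorial_eval B k * c k) (hermite k))"
proof (cases "B = 0")
  case True
  then show ?thesis by (simp add: factorial_eval_def)
next
  case False
  obtain m B' where B': "B = [:0, 1:] ^ m * B'" "\<not> [:0, 1:] dvd B'"
    using order_decomp[OF False, of 0] by (metis minus_zero)
  have "B' \<noteq> 0" "only_real_zeros B'"
    using only_real_zeros_mult[of "[:0, 1:] ^ m" B'] B(1) False B'(1) by auto
  then obtain l rs where l: "B' = smult l (\<Prod>r\<leftarrow>rs. [:-r, 1:])" "l \<noteq> 0"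
    using only_real_zeros_factorization by metis
  define us where "us = map uminus rs"
  have prod: "(\<Prod>r\<leftarrow>rs. [:-r, 1:]) = (\<Prod>u\<leftarrow>us. [:u, 1:])"
    by (simp add: us_def o_def)
  have us: "\<forall>u\<in>set us. u > 0"
  proof
    fix u assume u: "u \<in> set us"
    have "poly (\<Prod>u\<leftarrow>us. [:u, 1:]) (-u) = 0"
      using u by (induction us) auto
    then have root: "poly B' (-u) = 0"
      by (simp add: l prod)
    then have "u \<noteq> 0"
      using B'(2) by (auto simp: poly_eq_0_iff_dvd)
    moreover have "\<not> u < 0"
    proof
      assume "u < 0"
      have "poly B (-u) = 0"
        using root by (simp add: B'(1))
      moreover have "lead_coeff B > 0"
        using B(2)[of "degree B"] False leading_coeff_0_iff[of B] by linarith
      then have "poly B (-u) > 0"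
        unfolding poly_altdef using \<open>u < 0\<close> B(2)
        by (intro sum_pos2[of _ "degree B"] mult_pos_pos mult_nonneg_nonneg) simp_all
      ultimately show False by simp
    qed
    ultimately show "u > 0" by simp
  qed
  have "(\<Prod>u\<leftarrow>replicate m 0 @ us. [:u, 1:]) = [:0, 1:] ^ m * (\<Prod>u\<leftarrow>us. [:u, 1:])"
    by (induction m) simp_all
  then have e: "factorial_eval B k = l * factorial_eval (\<Prod>u\<leftarrow>replicate m 0 @ us. [:u, 1:]) k" for k
    by (simp add: B'(1) l(1) prod factorial_eval_smult)
  let ?f = "\<Sum>k\<le>n. smult (c k) (hermite k)"
  have "cpoly ?f = 0 \<or> uhp_stable (cpoly ?f)"
    using real by (auto simp: only_real_zeros_iff_stable)
  from stable_or_0_normal_op_zeros[OF us this, of m]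
  have "smult l (normal_op (replicate m 0 @ us) (cpoly ?f)) = 0 \<or>
      uhp_stable (smult l (normal_op (replicate m 0 @ us) (cpoly ?f)))"
    using l(2) uhp_stable_smult by (metis of_real_eq_0_iff smult_0_right)
  also have "smult (complex_of_real l) (normal_op (replicate m 0 @ us) (cpoly ?f))
      = cpoly (\<Sum>k\<le>n. smult (factorial_eval B k * c k) (hermite k))"
    unfolding cpoly_sum normal_op_sum cpoly_smult normal_op_smult normal_op_hermite e
    by (rule poly_eqI) (simp add: coeff_sum sum_distrib_left mult_ac)
  finally show ?thesis
    by (simp add: only_real_zeros_iff_stable cpoly_eq_0_iff)
qed

text \<open>Divided by H_m the combination is a + 2b times a function with positive imaginary part
  on the upper half-plane, so it cannot vanish there unless b = 0. This settles sequences with at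
  most two consecutive nonzero terms.\<close>

lemma only_real_zeros_hermite_consecutive:
  "only_real_zeros (smult a (hermite m) + smult b (hermite (Suc m)))"
proof -
  let ?H = "cpoly (hermite m)" and ?G = "cpoly (smult a (hermite m) + smult b (hermite (Suc m)))"
  have G: "?G = smult (complex_of_real a) ?H + smult (complex_of_real (2 * b)) (creation ?H)"
    by (simp add: cpoly_add cpoly_smult creation_hermite del: hermite.simps)
  show ?thesis
  proof (cases "b = 0")
    case True
    then show ?thesis
      using only_real_zeros_smult uhp_stable_hermite by (auto simp: only_real_zeros_iff_stable[of "hermite m"])
  next
    case False
    have "uhp_stable ?G"
      unfolding uhp_stable_def
    proof (intro allI impI notI)
      fix z assume z: "Im z > 0" and zero: "poly ?G z = 0"
      have H0: "poly ?H z \<noteq> 0"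
        using uhp_stable_hermite z by (simp add: uhp_stable_def)
      have "poly ?G z / poly ?H z = complex_of_real a + complex_of_real (2 * b) * (poly (creation ?H) z / poly ?H z)"
        unfolding G using H0 by (simp add: add_divide_distrib)
      then have "Im (complex_of_real a + complex_of_real (2 * b) * (poly (creation ?H) z / poly ?H z)) = 0"
        using zero by simp
      then show False
        using False Im_creation_quotient[OF uhp_stable_hermite z, of m]
        by (simp only: plus_complex.sel times_complex.sel Re_complex_of_real Im_complex_of_real) simp
    qed
    then show ?thesis by (simp add: only_real_zeros_iff_stable)
  qed
qed

section \<open>Sequences with real-rooted Jensen polynomials\<close>

definition jensen :: "(nat \<Rightarrow> real) \<Rightarrow> nat \<Rightarrow> real poly" where
  "jensen g n = (\<Sum>k\<le>n. monom (real (n choose k) * g k) k)"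

definition jensen_real :: "(nat \<Rightarrow> real) \<Rightarrow> bool" where
  "jensen_real g \<longleftrightarrow> (\<forall>n. only_real_zeros (jensen g n))"

lemma coeff_jensen: "coeff (jensen g n) k = real (n choose k) * g k"
  by (simp add: jensen_def coeff_sum sum.delta binomial_eq_0)

text \<open>Differentiating a Jensen polynomial shifts the sequence, and differentiation keeps all
  zeros real.\<close>

lemma jensen_real_shift:
  assumes "jensen_real g"
  shows "jensen_real (\<lambda>k. g (Suc k))"
  unfolding jensen_real_def
proof
  fix n
  have "pderiv (jensen g (Suc n)) = smult (real (Suc n)) (jensen (\<lambda>k. g (Suc k)) n)"
  proof (rule poly_eqI)
    fix k
    have "real (Suc k) * real (Suc n choose Suc k) = real (Suc n) * real (n choose k)"
      unfolding of_nat_mult[symmetric] Suc_times_binomial by simp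
    then show "coeff (pderiv (jensen g (Suc n))) k = coeff (smult (real (Suc n)) (jensen (\<lambda>k. g (Suc k)) n)) k"
      by (simp add: coeff_pderiv coeff_jensen mult.assoc[symmetric] del: binomial_Suc_Suc of_nat_Suc)
  qed
  moreover have "only_real_zeros (pderiv (jensen g (Suc n)))"
    using assms by (auto simp: jensen_real_def intro: only_real_zeros_pderiv)
  ultimately have "only_real_zeros (smult (inverse (real (Suc n))) (smult (real (Suc n)) (jensen (\<lambda>k. g (Suc k)) n)))"
    by (metis only_real_zeros_smult)
  then show "only_real_zeros (jensen (\<lambda>k. g (Suc k)) n)"
    by (simp del: of_nat_Suc)
qed

section \<open>Newton's difference formula as a change of variable in the Jensen polynomials\<close>

definition newton_sum :: "(nat \<Rightarrow> real) \<Rightarrow> nat \<Rightarrow> real" where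
  "newton_sum b k = (\<Sum>j\<le>k. real (k choose j) * b j)"

text \<open>By Pascal's rule, taking differences of the sum amounts to shifting \<open>b\<close>.
  Iterating, \<open>b j\<close> is the j-th difference at 0.\<close>

lemma newton_sum_Suc: "newton_sum b (Suc k) - newton_sum b k = newton_sum (\<lambda>j. b (Suc j)) k"
proof -
  have "newton_sum b (Suc k) = b 0 + (\<Sum>j\<le>k. real (Suc k choose Suc j) * b (Suc j))"
    unfolding newton_sum_def by (subst sum.atMost_Suc_shift) simp
  also have "\<dots> = newton_sum (\<lambda>j. b (Suc j)) k + (b 0 + (\<Sum>j\<le>k. real (k choose Suc j) * b (Suc j)))"
    by (simp add: newton_sum_def sum.distrib distrib_right)
  also have "b 0 + (\<Sum>j\<le>k. real (k choose Suc j) * b (Suc j)) = (\<Sum>j\<le>Suc k. real (k choose j) * b j)"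
    by (subst sum.atMost_Suc_shift) simp
  also have "\<dots> = newton_sum b k"
    by (simp add: newton_sum_def)
  finally show ?thesis by simp
qed

lemma ex_newton_sum: "\<exists>b. g = newton_sum b"
proof -
  define D where "D = (\<lambda>(g :: nat \<Rightarrow> real) k. g (Suc k) - g k)"
  have "g k = newton_sum (\<lambda>j. (D ^^ j) g 0) k" for k
  proof (induction k arbitrary: g)
    case 0
    show ?case by (simp add: newton_sum_def)
  next
    case (Suc k)
    have "g (Suc k) = g k + D g k"
      by (simp add: D_def)
    also have "\<dots> = newton_sum (\<lambda>j. (D ^^ j) g 0) k + newton_sum (\<lambda>j. (D ^^ j) (D g) 0) k"
      using Suc[of g] Suc[of "D g"] by simp
    also have "\<dots> = newton_sum (\<lambda>j. (D ^^ j) g 0) (Suc k)"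
      using newton_sum_Suc[of "\<lambda>j. (D ^^ j) g 0" k] by (simp add: funpow_swap1)
    finally show ?case .
  qed
  then show ?thesis by blast
qed

text \<open>The Jensen polynomial with its coefficients reversed. Reversal turns the Moebius
  transformation between the Jensen polynomials of \<open>b\<close> and \<open>newton_sum b\<close>
  into a translation.\<close>

definition appell :: "(nat \<Rightarrow> real) \<Rightarrow> nat \<Rightarrow> real poly" where
  "appell g n = (\<Sum>k\<le>n. monom (real (n choose k) * g k) (n - k))"

lemma poly_cpoly_jensen: "poly (cpoly (jensen g n)) z = (\<Sum>k\<le>n. complex_of_real (real (n choose k) * g k) * z ^ k)"
  by (simp add: jensen_def cpoly_sum poly_sum map_poly_monom poly_monom)

lemma poly_cpoly_appell: "poly (cpoly (appell g n)) z = (\<Sum>k\<le>n. complex_of_real (real (n choose k) * g k) * z ^ (n - k))"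
  by (simp add: appell_def cpoly_sum poly_sum map_poly_monom poly_monom)

text \<open>For nonzero z, inversion preserves reality, and a possible zero at 0 is real anyway. The
  coefficient comparison handles the zero polynomial.\<close>

lemma only_real_zeros_appell_iff: "only_real_zeros (appell g n) \<longleftrightarrow> only_real_zeros (jensen g n)"
proof -
  have rev: "poly (cpoly (appell g n)) z = z ^ n * poly (cpoly (jensen g n)) (1 / z)" if "z \<noteq> 0" for z
    unfolding poly_cpoly_jensen poly_cpoly_appell sum_distrib_left
    using that by (intro sum.cong refl) (simp add: power_diff power_one_over)
  have "appell g n = 0 \<longleftrightarrow> jensen g n = 0"
  proof -
    have "coeff (appell g n) (n - k) = coeff (jensen g n) k" if "k \<le> n" for k
    proof -
      have "coeff (appell g n) (n - k) = (\<Sum>j\<le>n. if j = k then real (n choose j) * g j else 0)"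
        unfolding appell_def coeff_sum coeff_monom using that by (intro sum.cong) auto
      then show ?thesis
        using that by (simp add: coeff_jensen sum.delta)
    qed
    moreover have "degree (appell g n) \<le> n" "degree (jensen g n) \<le> n"
      unfolding appell_def jensen_def
      by (auto intro!: degree_sum_le order.trans[OF degree_monom_le])
    ultimately show ?thesis
      by (auto simp: poly_eq_iff) (metis coeff_eq_0 diff_diff_cancel diff_le_self le_less_trans not_less coeff_0)+
  qed
  moreover have nonreal: "Im (1 / z) = 0 \<longleftrightarrow> Im z = 0" for z
    by (auto simp: Im_divide complex_neq_0)
  have "(\<forall>z. poly (cpoly (appell g n)) z = 0 \<longrightarrow> Im z = 0) \<longleftrightarrow>
      (\<forall>z. poly (cpoly (jensen g n)) z = 0 \<longrightarrow> Im z = 0)"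
  proof safe
    fix z assume *: "\<forall>z. poly (cpoly (appell g n)) z = 0 \<longrightarrow> Im z = 0" "poly (cpoly (jensen g n)) z = 0"
    show "Im z = 0"
    proof (cases "z = 0")
      case False
      then show ?thesis
        using * rev[of "1 / z"] nonreal[of z] by auto
    qed simp
  next
    fix z assume *: "\<forall>z. poly (cpoly (jensen g n)) z = 0 \<longrightarrow> Im z = 0" "poly (cpoly (appell g n)) z = 0"
    show "Im z = 0"
    proof (cases "z = 0")
      case False
      then show ?thesis
        using * rev[of z] nonreal[of z] by auto
    qed simp
  qed
  ultimately show ?thesis
    by (simp add: only_real_zeros_def)
qed

text \<open>Umbrally, \<open>appell g n\<close> is \<open>(x + g)\<^sup>n\<close> and \<open>newton_sum\<close> replaces \<open>b\<close> by \<open>1 + b\<close>.\<close>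

lemma appell_newton_sum: "appell (newton_sum b) n = pcompose (appell b n) [:1, 1:]"
proof -
  have "poly (appell (newton_sum b) n) x = poly (pcompose (appell b n) [:1, 1:]) x" for x
  proof -
    have "poly (appell (newton_sum b) n) x
        = (\<Sum>k\<le>n. \<Sum>j\<le>k. real (n choose k) * real (k choose j) * b j * x ^ (n - k))"
      by (simp add: appell_def poly_sum poly_monom newton_sum_def sum_distrib_left sum_distrib_right mult.assoc)
    also have "\<dots> = (\<Sum>j\<le>n. \<Sum>k=j..n. real (n choose k) * real (k choose j) * b j * x ^ (n - k))"
      by (simp add: sum.Sigma)
        (rule sum.reindex_bij_witness[of _ "\<lambda>(j, k). (k, j)" "\<lambda>(k, j). (j, k)"]; auto)
    also have "\<dots> = (\<Sum>j\<le>n. real (n choose j) * b j * (x + 1) ^ (n - j))"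
    proof (intro sum.cong refl)
      fix j assume "j \<in> {..n}"
      then have j: "j \<le> n" by simp
      have "(\<Sum>k=j..n. real (n choose k) * real (k choose j) * b j * x ^ (n - k))
          = (\<Sum>k=j..n. real (n choose j) * b j * (real (n - j choose (k - j)) * x ^ (n - k)))"
      proof (intro sum.cong refl)
        fix k assume "k \<in> {j..n}"
        then have "real (n choose k) * real (k choose j) = real (n choose j) * real (n - j choose (k - j))"
          unfolding of_nat_mult[symmetric] by (simp add: choose_mult)
        then show "real (n choose k) * real (k choose j) * b j * x ^ (n - k)
            = real (n choose j) * b j * (real (n - j choose (k - j)) * x ^ (n - k))"
          by simp
      qed
      also have "\<dots> = real (n choose j) * b j * (\<Sum>k=j..n. real (n - j choose (k - j)) * x ^ (n - k))"
        by (simp add: sum_distrib_left)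
      also have "(\<Sum>k=j..n. real (n - j choose (k - j)) * x ^ (n - k))
          = (\<Sum>i\<le>n - j. real (n - j choose i) * x ^ (n - j - i))"
        by (rule sum.reindex_bij_witness[of _ "\<lambda>i. i + j" "\<lambda>k. k - j"]) (use j in auto)
      also have "\<dots> = (1 + x) ^ (n - j)"
        by (subst binomial_ring) simp
      finally show "(\<Sum>k=j..n. real (n choose k) * real (k choose j) * b j * x ^ (n - k))
          = real (n choose j) * b j * (x + 1) ^ (n - j)"
        by (simp add: add.commute)
    qed
    also have "\<dots> = poly (pcompose (appell b n) [:1, 1:]) x"
      by (simp add: appell_def poly_sum poly_monom poly_pcompose add.commute)
    finally show ?thesis .
  qed
  then show ?thesis
    by (simp add: poly_eq_poly_eq_iff[symmetric] fun_eq_iff)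
qed

lemma jensen_real_newton_sum_iff: "jensen_real (newton_sum b) \<longleftrightarrow> jensen_real b"
proof -
  have "only_real_zeros (pcompose p [:1, 1:]) \<longleftrightarrow> only_real_zeros p" for p
  proof
    assume "only_real_zeros (pcompose p [:1, 1:])"
    then have "only_real_zeros (pcompose (pcompose p [:1, 1:]) [:-1, 1:])"
      by (rule only_real_zeros_pcompose_linear) simp
    also have "pcompose (pcompose p [:1, 1:]) [:-1, 1:] = p"
      by (simp add: pcompose_assoc[symmetric] pcompose_pCons pcompose_idR)
    finally show "only_real_zeros p" .
  qed (simp add: only_real_zeros_pcompose_linear)
  then show ?thesis
    by (simp add: jensen_real_def only_real_zeros_appell_iff[symmetric] appell_newton_sum)
qed

lemma jensen_real_shift_add:
  assumes "jensen_real g"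
  shows "jensen_real (\<lambda>i. g (k + i))"
  using assms
proof (induction k)
  case (Suc k)
  then show ?case using jensen_real_shift[of "\<lambda>i. g (k + i)"] by simp
qed simp

section \<open>Log-concavity, its defect, and monotonicity of differences\<close>

lemma jensen_real_turan:
  assumes "jensen_real g"
  shows "g k * g (k + 2) \<le> (g (k + 1))\<^sup>2"
proof -
  have *: "g 0 * g 2 \<le> (g 1)\<^sup>2" if "jensen_real g" for g
  proof -
    have "jensen g 2 = [:g 0, 2 * g 1, g 2:]"
      by (simp add: jensen_def numeral_2_eq_2 monom_Suc monom_0)
    then show ?thesis
      using that only_real_zeros_quadratic[of "g 0" "g 1" "g 2"] unfolding jensen_real_def by metis
  qed
  show ?thesis
    using *[OF jensen_real_shift_add[OF assms, of k]] by simp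
qed

lemma jensen_real_cubic:
  assumes "jensen_real g" "g (k + 3) \<noteq> 0"
  shows "(g (k + 1) * g (k + 2) - g k * g (k + 3))\<^sup>2
    \<le> 4 * ((g (k + 1))\<^sup>2 - g k * g (k + 2)) * ((g (k + 2))\<^sup>2 - g (k + 1) * g (k + 3))"
proof -
  have *: "(g 1 * g 2 - g 0 * g 3)\<^sup>2 \<le> 4 * ((g 1)\<^sup>2 - g 0 * g 2) * ((g 2)\<^sup>2 - g 1 * g 3)"
    if "jensen_real g" "g 3 \<noteq> 0" for g
  proof -
    have "jensen g 3 = [:g 0, 3 * g 1, 3 * g 2, g 3:]"
      by (simp add: jensen_def numeral_2_eq_2 numeral_3_eq_3 monom_Suc monom_0)
    then show ?thesis
      using that only_real_zeros_cubic[of "g 0" "g 1" "g 2" "g 3"] unfolding jensen_real_def by metis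
  qed
  show ?thesis
    using *[OF jensen_real_shift_add[OF assms(1), of k]] assms(2) by simp
qed

text \<open>With \<open>u = \<surd>t\<close>, \<open>v = \<surd>t'\<close> the discriminant inequality says \<open>\<bar>1/u - 1/v\<bar> \<le> 1\<close>.\<close>

lemma turan_defect_step:
  fixes t t' :: real
  assumes "0 < t" "t \<le> 1" "0 \<le> t'" "t' \<le> 1" "(t + t' - t * t')\<^sup>2 \<le> 4 * t * t'"
  shows "0 < t'" "1 / sqrt t' \<le> 1 / sqrt t + 1"
proof -
  define u v where "u = sqrt t" and "v = sqrt t'"
  have uv: "t = u\<^sup>2" "t' = v\<^sup>2" "u > 0" "v \<ge> 0"
    using assms by (simp_all add: u_def v_def)
  have "(u\<^sup>2 + v\<^sup>2 - u\<^sup>2 * v\<^sup>2)\<^sup>2 \<le> (2 * u * v)\<^sup>2"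
    using assms(5) by (simp add: uv(1,2) power_mult_distrib)
  then have "u\<^sup>2 + v\<^sup>2 - u\<^sup>2 * v\<^sup>2 \<le> 2 * u * v"
    by (rule power2_le_imp_le) (use uv(3,4) in simp)
  then have "(u - v)\<^sup>2 \<le> (u * v)\<^sup>2"
    by (simp add: power2_eq_square algebra_simps)
  then have le: "u - v \<le> u * v"
    by (rule power2_le_imp_le) (use uv(3,4) in simp)
  then have v: "v > 0"
    using uv(3,4) by (cases "v = 0") auto
  then show "0 < t'"
    by (simp add: uv(2))
  show "1 / sqrt t' \<le> 1 / sqrt t + 1"
    using le v uv(3) unfolding u_def[symmetric] v_def[symmetric] by (simp add: field_simps)
qed

text \<open>For the defect t, the cubic inequality lets 1/sqrt(t) grow by at most 1 per step.
  Starting from the positive value at \<open>k0\<close>, with C = 1/sqrt(t(k0)), this gives the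
  quadratic rate.\<close>

lemma jensen_real_defect_growth:
  fixes g :: "nat \<Rightarrow> real"
  assumes "jensen_real g" and pos: "\<And>k. g (K + k) > 0" and nonneg: "\<And>k. g k \<ge> 0"
    and K: "K = Suc k0" and strict: "g k0 * g (k0 + 2) < (g (k0 + 1))\<^sup>2"
  obtains C where "C > 0" "\<And>i. 1 - g (k0 + i) * g (k0 + i + 2) / (g (k0 + i + 1))\<^sup>2 \<ge> 1 / (real i + C)\<^sup>2"
proof -
  define t where "t = (\<lambda>k. 1 - g k * g (k + 2) / (g (k + 1))\<^sup>2)"
  have gpos: "g (Suc k) > 0" if "k \<ge> k0" for k
    using pos[of "k - k0"] that by (simp add: K)
  have t01: "0 \<le> t k" "t k \<le> 1" if "k \<ge> k0" for k
    using jensen_real_turan[OF assms(1), of k] gpos[OF that] nonneg by (auto simp: t_def)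
  have cubic: "(t k + t (Suc k) - t k * t (Suc k))\<^sup>2 \<le> 4 * t k * t (Suc k)" if "k \<ge> k0" for k
  proof -
    define a b c d where "a = g k" and "b = g (k + 1)" and "c = g (k + 2)" and "d = g (k + 3)"
    have bcd: "b > 0" "c > 0" "d > 0"
      using gpos[of k] gpos[of "k + 1"] gpos[of "k + 2"] that by (auto simp: b_def c_def d_def numeral_3_eq_3 numeral_2_eq_2)
    have t: "t k = 1 - a * c / b\<^sup>2" "t (Suc k) = 1 - b * d / c\<^sup>2"
      by (simp_all add: t_def a_def b_def c_def d_def numeral_3_eq_3 numeral_2_eq_2)
    have "(b * c - a * d)\<^sup>2 \<le> 4 * (b\<^sup>2 - a * c) * (c\<^sup>2 - b * d)"
      using jensen_real_cubic[OF assms(1), of k] bcd unfolding a_def b_def c_def d_def by simp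
    \<comment> \<open>The first identity restates (1 - t(k)) (1 - t(k+1)) = a d / (b c).\<close>
    moreover have "b * c - a * d = b * c * (t k + t (Suc k) - t k * t (Suc k))"
      "b\<^sup>2 - a * c = b\<^sup>2 * t k" "c\<^sup>2 - b * d = c\<^sup>2 * t (Suc k)"
      using bcd unfolding t by (simp_all add: field_simps power2_eq_square)
    ultimately have "(b * c * (t k + t (Suc k) - t k * t (Suc k)))\<^sup>2 \<le> 4 * (b\<^sup>2 * t k) * (c\<^sup>2 * t (Suc k))"
      by (simp only:)
    then have "(b * c)\<^sup>2 * (t k + t (Suc k) - t k * t (Suc k))\<^sup>2 \<le> (b * c)\<^sup>2 * (4 * t k * t (Suc k))"
      by (simp only: power_mult_distrib mult_ac)
    then show ?thesis
      using bcd by (simp add: mult_le_cancel_left)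
  qed
  define C where "C = 1 / sqrt (t k0)"
  have t0: "t k0 > 0"
    using strict gpos[of k0] by (simp add: t_def)
  have *: "t (k0 + i) > 0 \<and> 1 / sqrt (t (k0 + i)) \<le> real i + C" for i
  proof (induction i)
    case 0
    then show ?case using t0 by (simp add: C_def)
  next
    case (Suc i)
    then show ?case
      using turan_defect_step[of "t (k0 + i)" "t (Suc (k0 + i))"] cubic[of "k0 + i"] t01[of "k0 + i"] t01[of "Suc (k0 + i)"]
      by simp
  qed
  show ?thesis
  proof (rule that[of C])
    show C: "C > 0"
      using t0 by (simp add: C_def)
    fix i
    have "1 / t (k0 + i) = (1 / sqrt (t (k0 + i)))\<^sup>2"
      using *[of i] by (simp add: power_divide)
    also have "\<dots> \<le> (real i + C)\<^sup>2"
      using *[of i] by (intro power_mono) auto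
    finally have "1 / (real i + C)\<^sup>2 \<le> t (k0 + i)"
      using *[of i] C by (simp add: field_simps add_nonneg_pos)
    then show "1 - g (k0 + i) * g (k0 + i + 2) / (g (k0 + i + 1))\<^sup>2 \<ge> 1 / (real i + C)\<^sup>2"
      by (simp add: t_def)
  qed
qed

text \<open>The defect bound makes the ratios R of consecutive terms fall by at least about i^-2,
  while monotonicity keeps them at least 1. Hence R - 1 is at least 1/(i+1+C), the sequence grows at
  least linearly, and its differences f(R - 1) stay above a positive constant.\<close>

lemma jensen_real_diff_bounded_below:
  fixes g :: "nat \<Rightarrow> real"
  assumes jr: "jensen_real g" and nonneg: "\<And>k. 0 \<le> g k" and mono: "\<And>k. g k \<le> g (Suc k)"
    and strict: "g k0 * g (k0 + 2) < (g (k0 + 1))\<^sup>2"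
  obtains c where "c > 0" "\<And>k. k > k0 \<Longrightarrow> c \<le> g (Suc k) - g k"
proof -
  have "g (Suc k0) > 0"
    using strict nonneg[of "Suc k0"] mult_nonneg_nonneg[OF nonneg[of k0] nonneg[of "k0 + 2"]]
    by (cases "g (Suc k0) = 0") auto
  then have pos: "g (Suc k0 + k) > 0" for k
    using lift_Suc_mono_le[of g "Suc k0" "Suc k0 + k"] mono by simp
  obtain C where C: "C > 0"
    and t: "\<And>i. 1 - g (k0 + i) * g (k0 + i + 2) / (g (k0 + i + 1))\<^sup>2 \<ge> 1 / (real i + C)\<^sup>2"
    using jensen_real_defect_growth[OF jr pos nonneg refl strict] by blast
  define f where "f = (\<lambda>i. g (Suc k0 + i))"
  define R where "R = (\<lambda>i. f (Suc i) / f i)"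
  have f: "f i > 0" "f i \<le> f (Suc i)" for i
    using pos[of i] mono[of "Suc k0 + i"] by (simp_all add: f_def)
  have R1: "R i \<ge> 1" for i
    using f[of i] by (simp add: R_def)
  \<comment> \<open>The comparison 1/x - 1/(x+1) <= 1/x^2 makes the drops of R telescope.\<close>
  have step: "R (Suc i) - 1 / (real (Suc i) + 1 + C) \<le> R i - 1 / (real i + 1 + C)" for i
  proof -
    define x where "x = real i + 1 + C"
    have x: "x > 0" using C by (simp add: x_def)
    have "1 / x\<^sup>2 \<le> 1 - R (Suc i) / R i"
    proof -
      have "R (Suc i) / R i = f i * f (Suc (Suc i)) / (f (Suc i))\<^sup>2"
        by (simp add: R_def power2_eq_square mult.commute)
      then show ?thesis
        using t[of "Suc i"] by (simp add: f_def x_def add_ac)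
    qed
    also have "\<dots> \<le> R i * (1 - R (Suc i) / R i)"
    proof -
      have "0 \<le> 1 - R (Suc i) / R i"
        using order.trans[OF _ calculation, of 0] by simp
      then show ?thesis
        using R1[of i] mult_right_mono[of 1 "R i" "1 - R (Suc i) / R i"] by simp
    qed
    also have "\<dots> = R i - R (Suc i)"
      using R1[of i] by (simp add: algebra_simps)
    finally have "R (Suc i) \<le> R i - 1 / x\<^sup>2" by simp
    moreover have "1 / x - 1 / (x + 1) = 1 / (x * (x + 1))"
      using x by (simp add: field_simps)
    moreover have "1 / (x * (x + 1)) \<le> 1 / x\<^sup>2"
      using x by (intro divide_left_mono) (auto simp: power2_eq_square)
    ultimately show ?thesis
      by (simp add: x_def algebra_simps)
  qed
  have R: "R i \<ge> 1 + 1 / (real i + 1 + C)" for i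
  proof -
    have "1 - 1 / (real (i + j) + 1 + C) \<le> R i - 1 / (real i + 1 + C)" for j
    proof -
      have "R (i + j) - 1 / (real (i + j) + 1 + C) \<le> R i - 1 / (real i + 1 + C)"
      proof (induction j)
        case (Suc j)
        then show ?case using step[of "i + j"] by simp
      qed simp
      then show ?thesis using R1[of "i + j"] by simp
    qed
    moreover have "(\<lambda>j. 1 - 1 / (real (i + j) + 1 + C)) \<longlonglongrightarrow> 1 - 0"
    proof (intro tendsto_intros tendsto_divide_0[OF tendsto_const] filterlim_at_top_imp_at_infinity)
      have "filterlim (\<lambda>j. (real i + 1 + C) + real j) at_top sequentially"
        by (rule filterlim_tendsto_add_at_top[OF tendsto_const filterlim_real_sequentially])
      then show "filterlim (\<lambda>j. real (i + j) + 1 + C) at_top sequentially"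
        by (simp add: algebra_simps)
    qed
    ultimately have "1 - 0 \<le> R i - 1 / (real i + 1 + C)"
      by (intro LIMSEQ_le_const2) auto
    then show ?thesis by simp
  qed
  have grow: "f i / (real i + 1 + C) \<ge> f 0 / (1 + C)" for i
  proof (induction i)
    case (Suc i)
    have "f (Suc i) \<ge> f i * (1 + 1 / (real i + 1 + C))"
      using R[of i] f(1)[of i] by (simp add: R_def field_simps)
    also have "f i * (1 + 1 / (real i + 1 + C)) = f i / (real i + 1 + C) * (real (Suc i) + 1 + C)"
      using C by (simp add: field_simps add_nonneg_eq_0_iff)
    finally have "f (Suc i) / (real (Suc i) + 1 + C) \<ge> f i / (real i + 1 + C)"
      using C by (subst pos_le_divide_eq) auto
    with Suc show ?case by simp
  qed simp
  show ?thesis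
  proof (rule that[of "f 0 / (1 + C)"])
    show "f 0 / (1 + C) > 0"
      using f(1)[of 0] C by simp
    fix k assume "k > k0"
    then obtain i where i: "k = Suc k0 + i"
      by (metis Suc_leI le_Suc_ex)
    have "f i * (1 / (real i + 1 + C)) \<le> f i * (R i - 1)"
      using R[of i] f(1)[of i] by (intro mult_left_mono) auto
    also have "f i * (R i - 1) = g (Suc k) - g k"
      using f(1)[of i] by (simp add: R_def f_def i field_simps)
    finally show "f 0 / (1 + C) \<le> g (Suc k) - g k"
      using grow[of i] by simp
  qed
qed

text \<open>If the defect vanishes identically, consecutive triples are geometric and the
  arithmetic-geometric mean inequality gives convexity. Otherwise the differences are eventually
  bounded below by a positive constant; since they are log-concave, a single decrease would make
  them decay geometrically.\<close>

lemma jensen_real_diff_mono: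
  fixes g :: "nat \<Rightarrow> real"
  defines "d \<equiv> (\<lambda>k. g (Suc k) - g k)"
  assumes jr: "jensen_real g" and jrd: "jensen_real d"
    and nonneg: "\<And>k. 0 \<le> g k" and mono: "\<And>k. g k \<le> g (Suc k)"
  shows "d k \<le> d (Suc k)"
proof (cases "\<exists>k0. g k0 * g (k0 + 2) < (g (k0 + 1))\<^sup>2")
  case False
  then have "g k * g (k + 2) = (g (k + 1))\<^sup>2"
    using jensen_real_turan[OF jr, of k] by (meson eq_iff not_le)
  then have "(2 * g (k + 1))\<^sup>2 \<le> (g k + g (k + 2))\<^sup>2"
    using zero_le_power2[of "g k - g (k + 2)"] by (simp add: power2_eq_square algebra_simps)
  then have "2 * g (k + 1) \<le> g k + g (k + 2)"
    by (rule power2_le_imp_le) (rule add_nonneg_nonneg[OF nonneg nonneg])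
  then show ?thesis
    by (simp add: d_def)
next
  case True
  then obtain k0 where "g k0 * g (k0 + 2) < (g (k0 + 1))\<^sup>2"
    by blast
  then obtain c where c: "c > 0" "\<And>k. k > k0 \<Longrightarrow> c \<le> d k"
    using jensen_real_diff_bounded_below[OF jr nonneg mono] unfolding d_def by blast
  have dn: "d k \<ge> 0" for k
    using mono by (simp add: d_def)
  show ?thesis
  proof (rule ccontr)
    assume "\<not> d k \<le> d (Suc k)"
    then have less: "d (Suc k) < d k" by simp
    then have dk: "d k > 0"
      using dn[of "Suc k"] by linarith
    \<comment> \<open>A vanishing difference would persist: if g(m+1) = g(m) > 0, log-concavity
      gives g(m+2) <= g(m+1). That contradicts the lower bound c.\<close>
    have pos: "d (k + i) > 0" for i
    proof (rule ccontr)
      assume "\<not> d (k + i) > 0"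
      then have z: "d (k + i) = 0"
        using dn[of "k + i"] by simp
      have "d (k + i + j) = 0" for j
      proof (induction j)
        case (Suc j)
        define m where "m = k + i + j"
        have eq: "g (Suc m) = g m"
          using Suc by (simp add: d_def m_def)
        have "g m > 0"
        proof -
          have "g (Suc k) > 0"
            using dk nonneg[of k] by (simp add: d_def)
          moreover have "i \<noteq> 0"
            using dk z by (cases "i = 0") auto
          then have "Suc k \<le> m"
            by (simp add: m_def)
          then have "g (Suc k) \<le> g m"
            by (rule lift_Suc_mono_le[of g, OF mono])
          ultimately show ?thesis
            by linarith
        qed
        moreover have "g m * g (m + 2) \<le> g m * g (m + 1)"
          using jensen_real_turan[OF jr, of m] by (simp add: eq power2_eq_square)
        ultimately have "g (m + 2) \<le> g (m + 1)"
          by simp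
        then show ?case
          using dn[of "Suc m"] by (simp add: d_def m_def)
      qed (simp add: z)
      from this[of "Suc k0"] c(2)[of "k + i + Suc k0"] c(1) show False
        by simp
    qed
    define q where "q = d (Suc k) / d k"
    have q: "0 < q" "q < 1"
      using less dk pos[of 1] by (simp_all add: q_def)
    have ratio: "d (Suc (k + i)) \<le> q * d (k + i)" for i
    proof (induction i)
      case 0
      then show ?case using dk by (simp add: q_def)
    next
      case (Suc i)
      have "d (k + i) * d (k + i + 2) \<le> d (k + i + 1) * d (k + i + 1)"
        using jensen_real_turan[OF jrd, of "k + i"] by (simp add: power2_eq_square)
      also have "\<dots> \<le> q * d (k + i) * d (k + i + 1)"
        using Suc dn by (intro mult_right_mono) auto
      finally have "d (k + i) * d (k + i + 2) \<le> d (k + i) * (q * d (k + i + 1))"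
        by (simp add: mult_ac)
      then show ?case
        using pos[of i] by simp
    qed
    have le: "d (k + i) \<le> q ^ i * d k" for i
    proof (induction i)
      case (Suc i)
      then show ?case
        using order.trans[OF ratio[of i] mult_left_mono[OF Suc, of q]] q by (simp add: mult.assoc)
    qed simp
    have "(\<lambda>i. q ^ i * d k) \<longlonglongrightarrow> 0 * d k"
      using q by (intro tendsto_mult LIMSEQ_power_zero tendsto_const) simp
    moreover have "\<forall>i\<ge>Suc k0. c \<le> q ^ i * d k"
    proof (intro allI impI)
      fix i assume "i \<ge> Suc k0"
      then have "c \<le> d (k + i)"
        by (intro c(2)) simp
      then show "c \<le> q ^ i * d k"
        using le[of i] by (rule order.trans)
    qed
    ultimately have "c \<le> 0 * d k"
      by (blast intro: LIMSEQ_le_const)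
    with c(1) show False by simp
  qed
qed

text \<open>\<open>N j\<close> is the j-th difference sequence. Real Jensen polynomials pass to
  every \<open>N j\<close> by shifting \<open>b\<close>, so the previous lemma propagates
  nonnegativity and monotonicity from one j to the next.\<close>

lemma jensen_real_newton_coeffs_nonneg:
  assumes "jensen_real (newton_sum b)" "\<And>k. 0 \<le> newton_sum b k" "\<And>k. newton_sum b k \<le> newton_sum b (Suc k)"
  shows "b j \<ge> 0"
proof -
  define N where "N = (\<lambda>j. newton_sum (\<lambda>i. b (j + i)))"
  have jr: "jensen_real (N j)" for j
    using jensen_real_shift_add[of b j] assms(1) by (simp add: N_def jensen_real_newton_sum_iff)
  have diff: "N j (Suc k) - N j k = N (Suc j) k" for j k
    by (simp add: N_def newton_sum_Suc)
  have "(\<forall>k. 0 \<le> N j k) \<and> (\<forall>k. N j k \<le> N j (Suc k))"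
  proof (induction j)
    case 0
    then show ?case using assms by (simp add: N_def)
  next
    case (Suc j)
    have "N (Suc j) k \<le> N (Suc j) (Suc k)" for k
      using jensen_real_diff_mono[OF jr[of j], unfolded diff, OF jr] Suc by blast
    moreover have "0 \<le> N (Suc j) k" for k
      using Suc diff[of j k] by (metis diff_ge_0_iff_ge)
    ultimately show ?case by blast
  qed
  then have "0 \<le> N j 0" by blast
  then show ?thesis
    by (simp add: N_def newton_sum_def)
qed

lemma tendsto_fact_binomial: "(\<lambda>n. fact j * real (Suc n choose j) / real (Suc n) ^ j) \<longlonglongrightarrow> 1"
proof -
  have "(\<lambda>n. \<Prod>i<j. (real (Suc n) - real i) / real (Suc n)) \<longlonglongrightarrow> (\<Prod>i<j. 1)"
  proof (intro tendsto_prod)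
    fix i
    have "(\<lambda>n. 1 - real i * inverse (real (Suc n))) \<longlonglongrightarrow> 1 - real i * 0"
      by (intro tendsto_intros LIMSEQ_inverse_real_of_nat)
    moreover have "(real (Suc n) - real i) / real (Suc n) = 1 - real i * inverse (real (Suc n))" for n
      by (simp add: field_simps del: of_nat_Suc)
    ultimately show "(\<lambda>n. (real (Suc n) - real i) / real (Suc n)) \<longlonglongrightarrow> 1"
      by simp
  qed
  moreover have "fact j * real (Suc n choose j) / real (Suc n) ^ j = (\<Prod>i<j. (real (Suc n) - real i) / real (Suc n))" for n
    by (simp add: binomial_gbinomial gbinomial_prod_rev prod_dividef atLeast0LessThan del: of_nat_Suc)
  ultimately show ?thesis by simp
qed

theorem hermite_multiplier_of_mono:
  assumes jr: "jensen_real g" and nonneg: "\<And>k. 0 \<le> g k" and mono: "\<And>k. g k \<le> g (Suc k)"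
  shows "Q_multiplier_sequence hermite_poly g"
  unfolding Q_multiplier_sequence_def hermite_poly_eq
proof (intro allI impI)
  fix c :: "nat \<Rightarrow> real" and n
  assume real: "only_real_zeros (\<Sum>k\<le>n. smult (c k) (hermite k))"
  obtain b where b: "g = newton_sum b"
    using ex_newton_sum by blast
  have b0: "b j \<ge> 0" for j
    using jensen_real_newton_coeffs_nonneg assms unfolding b by blast
  have jb: "jensen_real b"
    using jr by (simp add: b jensen_real_newton_sum_iff)
  \<comment> \<open>Scaling the variable by 1/(i+1) makes the coefficients tend to
    \<open>b j / fact j\<close>, so that \<open>factorial_eval (B i) k\<close> tends to Newton's
    sum, which is \<open>g k\<close>.\<close>
  define B where "B = (\<lambda>i. pcompose (jensen b (Suc i)) [:0, 1 / real (Suc i):])"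
  have coeff_B: "coeff (B i) j = real (Suc i choose j) / real (Suc i) ^ j * b j" for i j
    by (simp add: B_def coeff_pcompose_linear coeff_jensen power_one_over divide_inverse power_inverse mult_ac del: of_nat_Suc)
  let ?p = "\<lambda>i. \<Sum>k\<le>n. smult (factorial_eval (B i) k * c k) (hermite k)"
  show "only_real_zeros (\<Sum>k\<le>n. smult (g k * c k) (hermite k))"
  proof (rule only_real_zeros_limit[where p = ?p and F = sequentially and n = n])
    show "\<forall>\<^sub>F i in sequentially. only_real_zeros (?p i)"
    proof (intro always_eventually allI only_real_zeros_hermite_factorial_eval real)
      fix i
      show "only_real_zeros (B i)"
        unfolding B_def using jb by (intro only_real_zeros_pcompose_linear) (auto simp: jensen_real_def)
      show "coeff (B i) j \<ge> 0" for j
        using b0 by (simp add: coeff_B)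
    qed
    show "degree (?p i) \<le> n" for i
      by (intro degree_sum_le order.trans[OF degree_smult_le] order.trans[OF degree_hermite_le]) auto
    show "degree (\<Sum>k\<le>n. smult (g k * c k) (hermite k)) \<le> n"
      by (intro degree_sum_le order.trans[OF degree_smult_le] order.trans[OF degree_hermite_le]) auto
    have lim: "(\<lambda>i. factorial_eval (B i) k) \<longlonglongrightarrow> g k" for k
    proof -
      have "(\<lambda>i. \<Sum>j\<le>k. (fact j * real (Suc i choose j) / real (Suc i) ^ j) * (real (k choose j) * b j))
          \<longlonglongrightarrow> (\<Sum>j\<le>k. 1 * (real (k choose j) * b j))"
        by (intro tendsto_intros tendsto_fact_binomial)
      then show ?thesis
        by (simp add: factorial_eval_def coeff_B b newton_sum_def mult_ac del: of_nat_Suc)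
    qed
    show "(\<lambda>i. coeff (?p i) j) \<longlonglongrightarrow> coeff (\<Sum>k\<le>n. smult (g k * c k) (hermite k)) j" for j
      unfolding coeff_sum coeff_smult by (intro tendsto_intros lim)
  qed simp
qed

section \<open>Legendre polynomials\<close>

fun legendre :: "nat \<Rightarrow> real poly" where
  "legendre 0 = 1"
| "legendre (Suc 0) = [:0, 1:]"
| "legendre (Suc (Suc n)) = smult ((2 * real n + 3) / (real n + 2)) ([:0, 1:] * legendre (Suc n))
     - smult ((real n + 1) / (real n + 2)) (legendre n)"

lemma legendre_recurrence:
  "(real n + 2) * poly (legendre (Suc (Suc n))) x
    = (2 * real n + 3) * x * poly (legendre (Suc n)) x - (real n + 1) * poly (legendre n) x"
proof -
  have "d * (a / d * u - b / d * v) = a * u - b * v" if "d \<noteq> 0" for a b d u v :: real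
    using that by (simp add: field_simps)
  from this[of "real n + 2" "2 * real n + 3" "x * poly (legendre (Suc n)) x" "real n + 1" "poly (legendre n) x"]
  show ?thesis
    by (simp add: mult_ac)
qed

section \<open>Identification with the coefficients of the generating function\<close>

lemma legendre_bound: "\<bar>poly (legendre n) x\<bar> \<le> (2 * \<bar>x\<bar> + 1) ^ n"
proof (induction n rule: legendre.induct)
  case (3 n)
  let ?M = "2 * \<bar>x\<bar> + 1"
  have "\<bar>poly (legendre (Suc (Suc n))) x\<bar>
      \<le> \<bar>(2 * real n + 3) / (real n + 2)\<bar> * (\<bar>x\<bar> * \<bar>poly (legendre (Suc n)) x\<bar>)
        + \<bar>(real n + 1) / (real n + 2)\<bar> * \<bar>poly (legendre n) x\<bar>"
    using abs_triangle_ineq4[of "(2 * real n + 3) / (real n + 2) * (x * poly (legendre (Suc n)) x)"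
        "(real n + 1) / (real n + 2) * poly (legendre n) x"]
    by (simp only: legendre.simps poly_diff poly_smult poly_mult abs_mult) simp
  also have "\<dots> \<le> 2 * (\<bar>x\<bar> * ?M ^ Suc n) + 1 * ?M ^ n"
    using 3 by (intro add_mono mult_mono) (auto simp: field_simps)
  also have "?M ^ n \<le> ?M ^ Suc n"
    by (intro power_increasing) auto
  finally show ?case
    by (simp add: algebra_simps)
qed auto

text \<open>With W = 1 - 2xs + s^2, the recurrence says W F' = (x - s) F for the power series F.
  Hence F sqrt(W) has derivative 0 and equals its value 1 at s = 0.\<close>

lemma legendre_generating:
  assumes t: "\<bar>t\<bar> < 1 / (2 * (2 * \<bar>x\<bar> + 1))"
  shows "(\<lambda>k. poly (legendre k) x * t ^ k) sums (1 / sqrt (1 - 2 * x * t + t\<^sup>2))"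
proof -
  define M where "M = 2 * \<bar>x\<bar> + 1"
  \<comment> \<open>Half of the radius 1/M from \<open>legendre_bound\<close>: the series is
    dominated by powers of 1/2, and W stays positive for |s| < r.\<close>
  define r where "r = 1 / (2 * M)"
  have M: "M \<ge> 1" and r: "r > 0"
    by (simp_all add: M_def r_def)
  define F where "F = Abs_fps (\<lambda>k. poly (legendre k) x)"
  have "summable (\<lambda>k. poly (legendre k) x * r ^ k)"
  proof (rule summable_comparison_test')
    show "summable (\<lambda>k. (1 / 2 :: real) ^ k)"
      by (simp add: summable_geometric)
    show "norm (poly (legendre k) x * r ^ k) \<le> (1 / 2) ^ k" for k
    proof -
      have "\<bar>poly (legendre k) x\<bar> * r ^ k \<le> M ^ k * r ^ k"
        using legendre_bound[of k x] r by (intro mult_right_mono) (auto simp: M_def)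
      also have "M ^ k * r ^ k = (1 / 2) ^ k"
        using M by (simp add: r_def flip: power_mult_distrib)
      finally show ?thesis
        using r by (simp add: abs_mult)
    qed
  qed
  then have rad: "fps_conv_radius F \<ge> ereal r"
    using conv_radius_geI[of "\<lambda>k. poly (legendre k) x" r] r by (simp add: fps_conv_radius_def F_def)
  define W where "W = (\<lambda>s. 1 - 2 * x * s + s\<^sup>2)"
  have W: "W s > 0" if "\<bar>s\<bar> < r" for s
  proof -
    have "2 * \<bar>x\<bar> * \<bar>s\<bar> \<le> M * r"
      using that r by (intro mult_mono) (auto simp: M_def)
    also have "M * r = 1 / 2"
      using M by (simp add: r_def)
    finally have "2 * \<bar>x\<bar> * \<bar>s\<bar> < 1" by simp
    moreover have "2 * x * s \<le> 2 * \<bar>x\<bar> * \<bar>s\<bar>"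
      using abs_ge_self[of "2 * x * s"] by (simp add: abs_mult)
    ultimately show ?thesis
      unfolding W_def using zero_le_power2[of s] by linarith
  qed
  have ode: "W s * eval_fps (fps_deriv F) s = (x - s) * eval_fps F s" if s: "\<bar>s\<bar> < r" for s
  proof -
    have fps: "fps_of_poly [:1, - 2 * x, 1:] * fps_deriv F = fps_of_poly [:x, - 1:] * F"
    proof (rule fps_ext)
      fix n
      consider "n = 0" | "n = Suc 0" | m where "n = Suc (Suc m)"
        by (metis not0_implies_Suc)
      then show "fps_nth (fps_of_poly [:1, - 2 * x, 1:] * fps_deriv F) n = fps_nth (fps_of_poly [:x, - 1:] * F) n"
      proof cases
        case 3
        then show ?thesis
          using legendre_recurrence[of "Suc m" x]
          by (simp add: F_def fps_of_poly_pCons algebra_simps del: legendre.simps(3))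
      qed (simp_all add: F_def fps_of_poly_pCons algebra_simps)
    qed
    have 1: "norm s < fps_conv_radius F"
      using s rad by (metis ereal_less_ereal_Ex less_le_trans real_norm_def less_ereal.simps(1))
    then have 2: "norm s < fps_conv_radius (fps_deriv F)"
      using fps_conv_radius_deriv[of F] less_le_trans by blast
    have "eval_fps (fps_of_poly [:1, - 2 * x, 1:] * fps_deriv F) s = W s * eval_fps (fps_deriv F) s"
      using 2 by (subst eval_fps_mult) (auto simp: W_def power2_eq_square algebra_simps)
    moreover have "eval_fps (fps_of_poly [:x, - 1:] * F) s = (x - s) * eval_fps F s"
      using 1 by (subst eval_fps_mult) auto
    ultimately show ?thesis
      using fps by simp
  qed
  have "\<exists>c. \<forall>s\<in>ball 0 r. eval_fps F s * sqrt (W s) = c"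
  proof (rule has_field_derivative_zero_constant)
    fix s assume "s \<in> ball (0::real) r"
    then have s: "\<bar>s\<bar> < r" by (simp add: dist_real_def)
    have 1: "norm s < fps_conv_radius F"
      using s rad by (metis ereal_less_ereal_Ex less_le_trans real_norm_def less_ereal.simps(1))
    have dW: "(W has_real_derivative 2 * s - 2 * x) (at s within ball 0 r)"
      unfolding W_def by (auto intro!: derivative_eq_intros)
    have "((\<lambda>s. eval_fps F s * sqrt (W s)) has_real_derivative
        eval_fps (fps_deriv F) s * sqrt (W s) + (2 * s - 2 * x) * (inverse (sqrt (W s)) / 2) * eval_fps F s) (at s within ball 0 r)"
      using DERIV_mult[OF has_field_derivative_eval_fps[OF 1] DERIV_chain2[OF DERIV_real_sqrt[OF W[OF s]] dW]]
      by (simp add: mult_ac)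
    moreover have "eval_fps (fps_deriv F) s * sqrt (W s) + (2 * s - 2 * x) * (inverse (sqrt (W s)) / 2) * eval_fps F s
        = (W s * eval_fps (fps_deriv F) s - (x - s) * eval_fps F s) / sqrt (W s)"
    proof -
      define q where "q = sqrt (W s)"
      have "W s = q * q" "q > 0"
        using W[OF s] by (simp_all add: q_def)
      then show ?thesis
        unfolding q_def[symmetric] by (simp add: field_simps)
    qed
    ultimately show "((\<lambda>s. eval_fps F s * sqrt (W s)) has_real_derivative 0) (at s within ball 0 r)"
      using ode[OF s] by simp
  qed simp
  then obtain c where c: "\<And>s. \<bar>s\<bar> < r \<Longrightarrow> eval_fps F s * sqrt (W s) = c"
    by (auto simp: dist_real_def)
  have "c = 1"
    using c[of 0] r by (simp add: W_def eval_fps_at_0 F_def)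
  have tr: "\<bar>t\<bar> < r"
    using t by (simp add: r_def M_def)
  then have "eval_fps F t = 1 / sqrt (W t)"
    using c[of t] W[of t] \<open>c = 1\<close> by (simp add: field_simps)
  moreover have "norm t < fps_conv_radius F"
    using tr rad by (metis ereal_less_ereal_Ex less_le_trans real_norm_def less_ereal.simps(1))
  then have "(\<lambda>k. fps_nth F k * t ^ k) sums eval_fps F t"
    by (rule sums_eval_fps)
  ultimately show ?thesis
    by (simp add: F_def W_def)
qed

lemma powser_eq_zero:
  fixes d :: "nat \<Rightarrow> real"
  assumes r: "r > 0" and sums: "\<And>t. \<bar>t\<bar> < r \<Longrightarrow> (\<lambda>n. d n * t ^ n) sums 0"
  shows "d n = 0"
proof (induction n rule: less_induct)
  case (less m)
  have "((\<lambda>_. 0) \<longlongrightarrow> d (0 + m)) (at (0::real))"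
  proof (rule powser_limit_0_strong[OF r])
    fix t :: real assume t: "t \<noteq> 0" "norm t < r"
    then have "(\<lambda>n. d (n + m) * t ^ (n + m)) sums (0 - (\<Sum>i<m. d i * t ^ i))"
      using sums[of t] by (subst sums_iff_shift) simp
    then have "(\<lambda>n. d (n + m) * t ^ (n + m) / t ^ m) sums (0 / t ^ m)"
      using less by (intro sums_divide) simp
    then show "(\<lambda>n. d (n + m) * t ^ n) sums 0"
      using t by (simp add: power_add)
  qed
  then show ?case
    by (simp add: tendsto_const_iff)
qed

lemma legendre_poly_eq: "legendre_poly = legendre"
  unfolding legendre_poly_def
proof (rule the_equality)
  show "\<forall>x::real. \<exists>r>0. \<forall>t::real. \<bar>t\<bar> < r \<longrightarrow>
       (\<lambda>k. poly (legendre k) x * t ^ k) sums (1 / sqrt (1 - 2 * x * t + t\<^sup>2))"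
  proof
    fix x :: real
    show "\<exists>r>0. \<forall>t::real. \<bar>t\<bar> < r \<longrightarrow> (\<lambda>k. poly (legendre k) x * t ^ k) sums (1 / sqrt (1 - 2 * x * t + t\<^sup>2))"
      by (intro exI[of _ "1 / (2 * (2 * \<bar>x\<bar> + 1))"] conjI allI impI legendre_generating) auto
  qed
  fix Q :: "nat \<Rightarrow> real poly"
  assume Q: "\<forall>x::real. \<exists>r>0. \<forall>t::real. \<bar>t\<bar> < r \<longrightarrow>
       (\<lambda>k. poly (Q k) x * t ^ k) sums (1 / sqrt (1 - 2 * x * t + t\<^sup>2))"
  have "poly (Q k) x = poly (legendre k) x" for k x
  proof -
    obtain r where r: "r > 0" "\<And>t. \<bar>t\<bar> < r \<Longrightarrow> (\<lambda>k. poly (Q k) x * t ^ k) sums (1 / sqrt (1 - 2 * x * t + t\<^sup>2))"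
      using Q by blast
    have "poly (Q k) x - poly (legendre k) x = 0"
    proof (rule powser_eq_zero)
      show "min r (1 / (2 * (2 * \<bar>x\<bar> + 1))) > 0"
        using r by auto
      fix t :: real assume "\<bar>t\<bar> < min r (1 / (2 * (2 * \<bar>x\<bar> + 1)))"
      then have "(\<lambda>n. poly (Q n) x * t ^ n - poly (legendre n) x * t ^ n) sums
          (1 / sqrt (1 - 2 * x * t + t\<^sup>2) - 1 / sqrt (1 - 2 * x * t + t\<^sup>2))"
        by (intro sums_diff r legendre_generating) auto
      then show "(\<lambda>n. (poly (Q n) x - poly (legendre n) x) * t ^ n) sums 0"
        by (simp add: left_diff_distrib)
    qed
    then show ?thesis by simp
  qed
  then show "Q = legendre"
    by (intro ext) (simp add: poly_eq_poly_eq_iff[symmetric] fun_eq_iff)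
qed

section \<open>Parity, leading coefficients and real zeros of the Legendre polynomials\<close>

lemma x_times_legendre:
  "[:0, 1:] * legendre (Suc n) = smult ((real n + 2) / (2 * real n + 3)) (legendre (Suc (Suc n)))
     + smult ((real n + 1) / (2 * real n + 3)) (legendre n)"
proof -
  have "x * poly (legendre (Suc n)) x = (real n + 2) / (2 * real n + 3) * poly (legendre (Suc (Suc n))) x
      + (real n + 1) / (2 * real n + 3) * poly (legendre n) x" for x
  proof -
    have "(2 * real n + 3) * (x * poly (legendre (Suc n)) x)
        = (real n + 2) * poly (legendre (Suc (Suc n))) x + (real n + 1) * poly (legendre n) x"
      using legendre_recurrence[of n x] by (simp add: mult.assoc del: legendre.simps(3))
    moreover have "y = p / d * u + q / d * v" if "d * y = p * u + q * v" "d \<noteq> 0" for d p q u v y :: real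
      using that by (simp add: field_simps)
    moreover have "2 * real n + 3 \<noteq> 0"
      by linarith
    ultimately show ?thesis
      by blast
  qed
  then show ?thesis
    by (simp add: poly_eq_poly_eq_iff[symmetric] fun_eq_iff del: legendre.simps(3))
qed

lemma legendre_reflect: "pcompose (legendre n) [:0, -1:] = smult ((-1) ^ n) (legendre n)"
proof (induction n rule: legendre.induct)
  case (3 n)
  then show ?case
    by (simp add: pcompose_diff pcompose_smult pcompose_mult pcompose_pCons smult_diff_right mult.commute)
qed (simp_all add: pcompose_1 pcompose_pCons)

lemma degree_legendre_le: "degree (legendre n) \<le> n"
proof (induction n rule: legendre.induct)
  case (3 n)
  have "degree ([:0, 1:] * legendre (Suc n)) \<le> Suc (Suc n)"
    using degree_mult_le[of "[:0, 1:]" "legendre (Suc n)"] 3(1) by simp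
  then show ?case
    unfolding legendre.simps using 3(2)
    by (intro degree_diff_le order.trans[OF degree_smult_le]) auto
qed auto

lemma lead_coeff_legendre_pos: "coeff (legendre n) n > 0"
proof (induction n rule: legendre.induct)
  case (3 n)
  have "coeff (legendre n) (Suc (Suc n)) = 0"
    using degree_legendre_le[of n] by (intro coeff_eq_0) simp
  with 3 show ?case by simp
qed auto

text \<open>The quotients P_(n+1)/P_n map the upper half-plane into itself: by the recurrence the
  next quotient is a z minus b times the reciprocal of the current one, with a, b > 0.\<close>

lemma uhp_stable_legendre: "uhp_stable (cpoly (legendre n))"
proof -
  have "uhp_stable (cpoly (legendre n)) \<and>
      (\<forall>z. Im z > 0 \<longrightarrow> Im (poly (cpoly (legendre (Suc n))) z / poly (cpoly (legendre n)) z) > 0)"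
  proof (induction n)
    case 0
    show ?case by (auto simp: uhp_stable_def map_poly_pCons)
  next
    case (Suc n)
    then have st: "uhp_stable (cpoly (legendre (Suc n)))"
      unfolding uhp_stable_def by (metis div_0 less_irrefl zero_complex.sel(2))
    moreover have "Im (poly (cpoly (legendre (Suc (Suc n)))) z / poly (cpoly (legendre (Suc n))) z) > 0"
      if z: "Im z > 0" for z
    proof -
      define a b where "a = (2 * real n + 3) / (real n + 2)" and "b = (real n + 1) / (real n + 2)"
      have ab: "a > 0" "b > 0" by (simp_all add: a_def b_def)
      define u where "u = poly (cpoly (legendre n)) z / poly (cpoly (legendre (Suc n))) z"
      have u: "Im u < 0"
        unfolding u_def using Suc z Im_divide_inverse by blast
      have "poly (cpoly (legendre (Suc (Suc n)))) z
          = complex_of_real a * (z * poly (cpoly (legendre (Suc n))) z) - complex_of_real b * poly (cpoly (legendre n)) z"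
        by (simp add: a_def b_def cpoly_diff cpoly_smult cpoly_mult map_poly_pCons)
      moreover have "poly (cpoly (legendre (Suc n))) z \<noteq> 0"
        using st z by (simp add: uhp_stable_def)
      ultimately have "poly (cpoly (legendre (Suc (Suc n)))) z / poly (cpoly (legendre (Suc n))) z
          = complex_of_real a * z - complex_of_real b * u"
        by (simp add: u_def field_simps)
      moreover have "a * Im z > 0" "b * Im u < 0"
        using ab z u by (simp_all add: mult_pos_neg)
      ultimately show ?thesis by simp
    qed
    ultimately show ?case by blast
  qed
  then show ?thesis ..
qed

lemma only_real_zeros_legendre: "only_real_zeros (legendre n)"
  by (simp add: only_real_zeros_iff_stable uhp_stable_legendre)

section \<open>Legendre multiplier sequences\<close>

lemma legendre_spans:
  "degree p \<le> n \<Longrightarrow> \<exists>c. p = (\<Sum>k\<le>n. smult (c k) (legendre k))"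
proof (induction n arbitrary: p)
  case 0
  then obtain a where "p = [:a:]"
    by (metis degree_eq_zeroE le_zero_eq)
  then show ?case
    by (intro exI[of _ "\<lambda>_. a"]) simp
next
  case (Suc n)
  let ?P = "legendre (Suc n)"
  define a where "a = coeff p (Suc n) / coeff ?P (Suc n)"
  have "degree (p - smult a ?P) \<le> n"
  proof (rule degree_le, intro allI impI)
    fix i assume "n < i"
    then consider "i = Suc n" | "Suc n < i" by linarith
    then show "coeff (p - smult a ?P) i = 0"
    proof cases
      case 1
      then show ?thesis
        using lead_coeff_legendre_pos[of "Suc n"] by (simp add: a_def)
    next
      case 2
      then have "coeff p i = 0" "coeff ?P i = 0"
        using Suc.prems degree_legendre_le[of "Suc n"] by (auto intro!: coeff_eq_0)
      then show ?thesis by simp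
    qed
  qed
  then obtain c where c: "p - smult a ?P = (\<Sum>k\<le>n. smult (c k) (legendre k))"
    using Suc.IH by blast
  have "p = (\<Sum>k\<le>n. smult (c k) (legendre k)) + smult a ?P"
    unfolding c[symmetric] by simp
  also have "\<dots> = (\<Sum>k\<le>Suc n. smult ((c(Suc n := a)) k) (legendre k))"
    by simp
  finally show ?case by blast
qed

text \<open>Rescaling the variable, \<open>p(x) \<mapsto> p(\<epsilon> x)\<close>, and letting \<open>\<epsilon> \<rightarrow> 0\<close> only keeps the leading terms
  of the Legendre polynomials.\<close>

lemma legendre_multiplier_classical:
  assumes mult: "Q_multiplier_sequence legendre g" and real: "only_real_zeros p" and deg: "degree p \<le> n"
  shows "only_real_zeros (\<Sum>j\<le>n. monom (g j * coeff p j) j)"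
proof -
  have "\<exists>c. monom 1 j = (\<Sum>k\<le>j. smult (c k) (legendre k))" for j
    by (rule legendre_spans) (simp add: degree_monom_le)
  then obtain u where u: "\<And>j. monom 1 j = (\<Sum>k\<le>j. smult (u j k) (legendre k))"
    by metis
  \<comment> \<open>\<open>V j\<close> is the image of x^j under the multiplier operator; its degree
    is at most j and its coefficient at x^j is \<open>g j\<close>.\<close>
  define V where "V = (\<lambda>j. \<Sum>k\<le>j. smult (g k * u j k) (legendre k))"
  have coeff_low: "coeff (legendre k) i = 0" if "k < i" for k i
    using that degree_legendre_le[of k] by (intro coeff_eq_0) simp
  have V_high: "coeff (V j) i = 0" if "j < i" for i j
    using that by (auto simp: V_def coeff_sum coeff_low intro!: sum.neutral)
  have V_top: "coeff (V j) j = g j" for j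
  proof -
    have top: "coeff (\<Sum>k\<le>j. smult (a k) (legendre k)) j = a j * coeff (legendre j) j" for a
    proof -
      have "coeff (\<Sum>k\<le>j. smult (a k) (legendre k)) j = (\<Sum>k\<le>j. if k = j then a k * coeff (legendre k) j else 0)"
        unfolding coeff_sum coeff_smult by (intro sum.cong) (auto simp: coeff_low)
      then show ?thesis by simp
    qed
    have "u j j * coeff (legendre j) j = 1"
      using top[of "u j"] unfolding u[symmetric] by simp
    then show ?thesis
      by (simp add: V_def top mult.assoc)
  qed
  define image where "image = (\<lambda>q. \<Sum>j\<le>n. smult (coeff q j) (V j))"
  have image_real: "only_real_zeros (image q)" if q: "only_real_zeros q" "degree q \<le> n" for q
  proof -
    define c where "c = (\<lambda>k. \<Sum>j\<le>n. if k \<le> j then coeff q j * u j k else 0)"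
    have expand: "(\<Sum>j\<le>n. smult (coeff q j) (\<Sum>k\<le>j. smult (h k * u j k) (legendre k)))
        = (\<Sum>k\<le>n. smult (h k * c k) (legendre k))" for h
    proof -
      have "(\<Sum>j\<le>n. smult (coeff q j) (\<Sum>k\<le>j. smult (h k * u j k) (legendre k)))
          = (\<Sum>j\<le>n. \<Sum>k\<le>n. if k \<le> j then smult (h k * (coeff q j * u j k)) (legendre k) else 0)"
      proof (intro sum.cong refl)
        fix j assume "j \<in> {..n}"
        then have "smult (coeff q j) (\<Sum>k\<le>j. smult (h k * u j k) (legendre k))
            = (\<Sum>k\<in>{..n} \<inter> {k. k \<le> j}. smult (h k * (coeff q j * u j k)) (legendre k))"
          by (intro poly_eqI) (auto simp: coeff_sum sum_distrib_left mult_ac intro!: sum.cong)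
        then show "smult (coeff q j) (\<Sum>k\<le>j. smult (h k * u j k) (legendre k))
            = (\<Sum>k\<le>n. if k \<le> j then smult (h k * (coeff q j * u j k)) (legendre k) else 0)"
          by (simp add: sum.inter_restrict)
      qed
      also have "\<dots> = (\<Sum>k\<le>n. \<Sum>j\<le>n. if k \<le> j then smult (h k * (coeff q j * u j k)) (legendre k) else 0)"
        by (rule sum.swap)
      also have "\<dots> = (\<Sum>k\<le>n. smult (h k * c k) (legendre k))"
        by (intro sum.cong refl poly_eqI)
          (auto simp: c_def coeff_sum sum_distrib_left sum_distrib_right mult_ac intro!: sum.cong)
      finally show ?thesis .
    qed
    have "q = (\<Sum>j\<le>n. smult (coeff q j) (monom 1 j))"
      using poly_as_sum_of_monoms'[OF q(2)] by (simp add: smult_monom)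
    also have "\<dots> = (\<Sum>k\<le>n. smult (c k) (legendre k))"
      using expand[of "\<lambda>_. 1"] by (simp add: u)
    finally have "only_real_zeros (\<Sum>k\<le>n. smult (c k) (legendre k))"
      using q(1) by simp
    then have "only_real_zeros (\<Sum>k\<le>n. smult (g k * c k) (legendre k))"
      using mult by (simp add: Q_multiplier_sequence_def)
    then show ?thesis
      using expand[of g] by (simp add: image_def V_def)
  qed
  define e where "e = (\<lambda>i::nat. inverse (real (Suc i)))"
  have e: "e i > 0" for i
    by (simp add: e_def)
  have e0: "e \<longlonglongrightarrow> 0"
    unfolding e_def by (rule LIMSEQ_inverse_real_of_nat)
  \<comment> \<open>Conjugation by the scaling multiplies coefficient k of \<open>V j\<close> by
    \<open>e i ^ (j - k)\<close>, leaving only k = j in the limit.\<close>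
  define q where "q = (\<lambda>i. pcompose (image (pcompose p [:0, e i:])) [:0, 1 / e i:])"
  have coeff_q: "coeff (q i) k = (\<Sum>j\<le>n. coeff p j * (e i ^ j / e i ^ k) * coeff (V j) k)" for i k
    by (simp add: q_def image_def coeff_pcompose_linear coeff_sum sum_distrib_right sum_distrib_left power_one_over field_simps)
  show ?thesis
  proof (rule only_real_zeros_limit[where p = q and F = sequentially and n = n])
    show "\<forall>\<^sub>F i in sequentially. only_real_zeros (q i)"
    proof (intro always_eventually allI)
      fix i
      have "e i \<noteq> 0" using e[of i] by simp
      then have "only_real_zeros (pcompose p [:0, e i:])" "degree (pcompose p [:0, e i:]) \<le> n"
        using real deg degree_pcompose_le[of p "[:0, e i:]"] by (auto intro: only_real_zeros_pcompose_linear)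
      then show "only_real_zeros (q i)"
        unfolding q_def using \<open>e i \<noteq> 0\<close> only_real_zeros_pcompose_linear[OF image_real] by simp
    qed
    show "degree (q i) \<le> n" for i
      by (intro degree_le allI impI) (auto simp: coeff_q V_high)
    show "degree (\<Sum>j\<le>n. monom (g j * coeff p j) j) \<le> n"
      by (intro degree_sum_le order.trans[OF degree_monom_le]) auto
    fix k
    have "(\<lambda>i. coeff p j * (e i ^ j / e i ^ k) * coeff (V j) k) \<longlonglongrightarrow> (if j = k then g j * coeff p j else 0)" for j
    proof -
      consider "j < k" | "j = k" | "k < j" by linarith
      then show ?thesis
      proof cases
        case 1
        then show ?thesis by (simp add: V_high)
      next
        case 2
        have "e i \<noteq> 0" for i using e[of i] by simp
        then show ?thesis using 2 by (simp add: V_top mult.commute)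
      next
        case 3
        have "e i ^ j / e i ^ k = e i ^ (j - k)" for i
          using 3 e[of i] by (simp add: power_diff)
        moreover have "(\<lambda>i. coeff p j * e i ^ (j - k) * coeff (V j) k) \<longlonglongrightarrow> coeff p j * 0 ^ (j - k) * coeff (V j) k"
          by (intro tendsto_intros e0)
        ultimately show ?thesis using 3 by (simp add: power_0_left)
      qed
    qed
    then have "(\<lambda>i. coeff (q i) k) \<longlonglongrightarrow> (\<Sum>j\<le>n. if j = k then g j * coeff p j else 0)"
      unfolding coeff_q by (intro tendsto_sum)
    then show "(\<lambda>i. coeff (q i) k) \<longlonglongrightarrow> coeff (\<Sum>j\<le>n. monom (g j * coeff p j) j) k"
      by (simp add: coeff_sum)
  qed simp
qed

section \<open>Signs, gaps and growth of Legendre multiplier sequences\<close>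

lemma legendre_multiplier_jensen_real:
  assumes "Q_multiplier_sequence legendre g"
  shows "jensen_real g"
  unfolding jensen_real_def
proof
  fix n
  have "only_real_zeros (\<Sum>j\<le>n. monom (g j * coeff ([:1, 1:] ^ n) j) j)"
    by (intro legendre_multiplier_classical[OF assms] only_real_zeros_power only_real_zeros_linear)
      (simp add: degree_linear_power)
  also have "(\<Sum>j\<le>n. monom (g j * coeff ([:1, 1:] ^ n) j) j) = jensen g n"
    unfolding jensen_def by (intro sum.cong refl) (simp add: coeff_linear_poly_power mult.commute)
  finally show "only_real_zeros (jensen g n)" .
qed

text \<open>The diagonal operator sends x^k (x^2 - 1) to x^k (g(k+2) x^2 - g(k)), which has nonreal
  zeros if the two values have opposite signs.\<close>

lemma legendre_multiplier_step_two_sign: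
  assumes "Q_multiplier_sequence legendre g"
  shows "g k * g (k + 2) \<ge> 0"
proof (cases "g k = 0")
  case False
  let ?p = "monom 1 k * ([:-1, 1:] * [:1, 1:]) :: real poly"
  have p: "?p = monom (-1) k + monom 1 (k + 2)"
    by (simp add: monom_altdef power_add power2_eq_square algebra_simps)
  have "only_real_zeros ?p"
    unfolding monom_altdef smult_1_left
    by (intro only_real_zeros_times only_real_zeros_power only_real_zeros_linear)
  moreover have "degree ?p \<le> k + 2"
    unfolding p by (intro degree_add_le order.trans[OF degree_monom_le]) auto
  ultimately have "only_real_zeros (\<Sum>j\<le>k + 2. monom (g j * coeff ?p j) j)"
    by (rule legendre_multiplier_classical[OF assms])
  also have "(\<Sum>j\<le>k + 2. monom (g j * coeff ?p j) j) = monom 1 k * [:- g k, 2 * 0, g (k + 2):]"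
    unfolding p by (rule poly_eqI) (auto simp: coeff_sum coeff_monom_mult coeff_pCons split: nat.splits)
  finally have "only_real_zeros (monom 1 k * [:- g k, 2 * 0, g (k + 2):])" .
  then have "only_real_zeros [:- g k, 2 * 0, g (k + 2):]"
    using False only_real_zeros_mult[of "monom 1 k"] by (metis mult_eq_0_iff monom_eq_0_iff neg_equal_0_iff_equal one_neq_zero pCons_eq_0_iff)
  from only_real_zeros_quadratic[OF this] show ?thesis by simp
qed simp

text \<open>The Jensen polynomial starting at m has nonzero constant term and no linear term. Were
  it nonconstant, the strict bottom inequality would make g(m) g(m+2) negative; so it is constant
  and its top coefficient g(k) vanishes.\<close>

lemma legendre_multiplier_no_gap:
  assumes mult: "Q_multiplier_sequence legendre g" and "g m \<noteq> 0" "g (Suc m) = 0" "k > m"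
  shows "g k = 0"
proof -
  define n where "n = k - m"
  have n: "n > 0" "k = m + n" using assms(4) by (simp_all add: n_def)
  let ?J = "jensen (\<lambda>i. g (m + i)) n"
  have J: "only_real_zeros ?J"
    using jensen_real_shift_add[OF legendre_multiplier_jensen_real[OF mult]] by (simp add: jensen_real_def)
  have "degree ?J = 0"
  proof (rule ccontr)
    assume "degree ?J \<noteq> 0"
    from only_real_zeros_bottom_coeffs(2)[OF J _ this] assms(2,3)
    have "real (n choose 2) * (g m * g (m + 2)) < 0"
      by (simp add: coeff_jensen mult_ac)
    moreover have "real (n choose 2) * (g m * g (m + 2)) \<ge> 0"
      by (intro mult_nonneg_nonneg legendre_multiplier_step_two_sign[OF mult]) simp
    ultimately show False by linarith
  qed
  then have "coeff ?J n = 0"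
    using n by (intro coeff_eq_0) simp
  then show ?thesis
    by (simp add: coeff_jensen n)
qed

text \<open>Among the three top coefficients only that of x^n involves b, and it does so affinely. A
  too large b/a would make the sum of the squared zeros negative.\<close>

lemma legendre_two_term_bound:
  "\<exists>K. \<forall>a>0. \<forall>b. only_real_zeros (smult a (legendre (n + 2)) + smult b (legendre n)) \<longrightarrow> b \<le> K * a"
proof -
  define l e f l' where "l = coeff (legendre (n + 2)) (n + 2)" and "e = coeff (legendre (n + 2)) n"
    and "f = coeff (legendre (n + 2)) (n + 1)" and "l' = coeff (legendre n) n"
  have l: "l > 0" "l' > 0"
    using lead_coeff_legendre_pos by (simp_all add: l_def l'_def del: legendre.simps)
  show ?thesis
  proof (intro exI[of _ "(f\<^sup>2 - 2 * l * e) / (2 * l * l')"] allI impI)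
    fix a b :: real
    let ?p = "smult a (legendre (n + 2)) + smult b (legendre n)"
    assume a: "a > 0" and real: "only_real_zeros ?p"
    have "degree ?p \<le> n + 2"
      using degree_legendre_le[of n]
      by (intro degree_add_le order.trans[OF degree_smult_le] degree_legendre_le) simp
    from only_real_zeros_top_coeffs[OF real this]
    have "2 * (a * l) * (a * e + b * l') \<le> (a * f)\<^sup>2"
      using degree_legendre_le[of n] by (simp add: l_def e_def f_def l'_def coeff_eq_0 del: legendre.simps)
    then have "a * (b * (2 * l * l')) \<le> a * ((f\<^sup>2 - 2 * l * e) * a)"
      by (simp add: power2_eq_square algebra_simps)
    then have "b * (2 * l * l') \<le> (f\<^sup>2 - 2 * l * e) * a"
      using a by simp
    then show "b \<le> (f\<^sup>2 - 2 * l * e) / (2 * l * l') * a"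
      using l by (simp add: pos_le_divide_eq)
  qed
qed

lemma legendre_multiplier_two_terms:
  assumes "Q_multiplier_sequence legendre g"
    and "only_real_zeros (smult a (legendre (n + 2)) + smult b (legendre n))"
  shows "only_real_zeros (smult (g (n + 2) * a) (legendre (n + 2)) + smult (g n * b) (legendre n))"
proof -
  define c where "c = (\<lambda>k. if k = n + 2 then a else if k = n then b else 0)"
  have *: "(\<Sum>k\<le>n + 2. smult (h k * c k) (legendre k))
      = smult (h (n + 2) * a) (legendre (n + 2)) + smult (h n * b) (legendre n)" for h
  proof -
    have "(\<Sum>k\<le>n + 2. smult (h k * c k) (legendre k)) = (\<Sum>k\<in>{n + 2, n}. smult (h k * c k) (legendre k))"
      by (rule sum.mono_neutral_right) (auto simp: c_def)
    then show ?thesis by (simp add: c_def del: legendre.simps)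
  qed
  have "only_real_zeros (\<Sum>k\<le>n + 2. smult (c k) (legendre k))"
    using assms(2) *[of "\<lambda>_. 1"] by (simp only: mult_1)
  then have "only_real_zeros (\<Sum>k\<le>n + 2. smult (g k * c k) (legendre k))"
    using assms(1) by (simp only: Q_multiplier_sequence_def)
  then show ?thesis
    by (simp only: *)
qed

text \<open>Iterating the operator on x P_(n+1) multiplies the ratio of its two Legendre
  coefficients by g(n)/g(n+2) each time, but this ratio is bounded.\<close>

lemma legendre_multiplier_step_two_mono:
  assumes mult: "Q_multiplier_sequence legendre g" and pos: "g n > 0" "g (n + 2) > 0"
  shows "g n \<le> g (n + 2)"
proof (rule ccontr)
  assume "\<not> g n \<le> g (n + 2)"
  then have q: "g n / g (n + 2) > 1"
    using pos by simp
  define a b where "a = (real n + 2) / (2 * real n + 3)" and "b = (real n + 1) / (2 * real n + 3)"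
  have ab: "a > 0" "b > 0" by (simp_all add: a_def b_def)
  have iter: "only_real_zeros (smult (g (n + 2) ^ i * a) (legendre (n + 2)) + smult (g n ^ i * b) (legendre n))" for i
  proof (induction i)
    case 0
    have "only_real_zeros ([:0, 1:] * legendre (Suc n))"
      by (intro only_real_zeros_times only_real_zeros_linear only_real_zeros_legendre)
    then show ?case
      unfolding x_times_legendre by (simp add: a_def b_def del: legendre.simps)
  next
    case (Suc i)
    from legendre_multiplier_two_terms[OF mult this] show ?case
      by (simp only: power_Suc mult.assoc)
  qed
  obtain K where K: "\<And>a b. a > 0 \<Longrightarrow> only_real_zeros (smult a (legendre (n + 2)) + smult b (legendre n)) \<Longrightarrow> b \<le> K * a"
    using legendre_two_term_bound by blast
  have "(g n / g (n + 2)) ^ i \<le> K * a / b" for i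
  proof -
    have "g n ^ i * b \<le> K * (g (n + 2) ^ i * a)"
      using pos ab by (intro K iter) simp
    then show ?thesis
      using pos ab by (simp add: power_divide field_simps)
  qed
  moreover obtain i where "K * a / b < (g n / g (n + 2)) ^ i"
    using real_arch_pow[OF q] by blast
  ultimately show False
    by (meson not_le)
qed

text \<open>\<open>x\<^sup>2 P\<^sub>n\<^sub>+\<^sub>2\<close> is a positive combination \<open>A P\<^sub>n\<^sub>+\<^sub>4 + B P\<^sub>n\<^sub>+\<^sub>2 + C P\<^sub>n\<close>. The image of
  \<open>(x\<^sup>2 - B + \<epsilon>) P\<^sub>n\<^sub>+\<^sub>2\<close> has no \<open>P\<^sub>n\<^sub>+\<^sub>4\<close>-term and an arbitrarily small \<open>P\<^sub>n\<^sub>+\<^sub>2\<close>-term.\<close>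

lemma legendre_multiplier_no_cutoff:
  assumes mult: "Q_multiplier_sequence legendre g" and pos: "g n > 0" "g (n + 2) > 0"
  shows "g (n + 4) \<noteq> 0"
proof
  assume zero: "g (n + 4) = 0"
  define \<alpha> \<beta> where "\<alpha> = (\<lambda>m. (real m + 2) / (2 * real m + 3))" and "\<beta> = (\<lambda>m. (real m + 1) / (2 * real m + 3))"
  have ab: "\<alpha> m > 0" "\<beta> m > 0" for m
    by (simp_all add: \<alpha>_def \<beta>_def)
  have x: "[:0, 1:] * legendre (Suc m) = smult (\<alpha> m) (legendre (Suc (Suc m))) + smult (\<beta> m) (legendre m)" for m
    unfolding \<alpha>_def \<beta>_def by (rule x_times_legendre)
  define A B C where "A = \<alpha> (n + 1) * \<alpha> (n + 2)"
    and "B = \<alpha> (n + 1) * \<beta> (n + 2) + \<beta> (n + 1) * \<alpha> n" and "C = \<beta> (n + 1) * \<beta> n"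
  have BC: "B > 0" "C > 0"
    using ab by (simp_all add: B_def C_def add_pos_pos)
  have x2: "[:0, 1:] * ([:0, 1:] * legendre (n + 2))
      = smult A (legendre (n + 4)) + smult B (legendre (n + 2)) + smult C (legendre n)"
  proof -
    have "[:0, 1:] * ([:0, 1:] * legendre (n + 2))
        = smult (\<alpha> (n + 1)) ([:0, 1:] * legendre (Suc (n + 2))) + smult (\<beta> (n + 1)) ([:0, 1:] * legendre (Suc n))"
      using x[of "n + 1"] by (simp add: algebra_simps smult_add_right del: legendre.simps)
    also have "\<dots> = smult A (legendre (n + 4)) + smult B (legendre (n + 2)) + smult C (legendre n)"
      unfolding x[of "n + 2"] x[of n]
      by (simp add: A_def B_def C_def smult_add_right smult_add_left algebra_simps eval_nat_numeral del: legendre.simps)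
    finally show ?thesis .
  qed
  obtain K where K: "\<And>a b. a > 0 \<Longrightarrow> only_real_zeros (smult a (legendre (n + 2)) + smult b (legendre n)) \<Longrightarrow> b \<le> K * a"
    using legendre_two_term_bound by blast
  have small: "g n * C \<le> K * (g (n + 2) * \<epsilon>)" if \<epsilon>: "0 < \<epsilon>" "\<epsilon> \<le> B" for \<epsilon>
  proof -
    \<comment> \<open>With this s, (x - s)(x + s) P_(n+2) has Legendre coefficients A,
      \<open>\<epsilon>\<close>, C; the bound \<open>\<epsilon> \<le> B\<close> keeps s
      real.\<close>
    define s where "s = sqrt (B - \<epsilon>)"
    define c where "c = (\<lambda>k. if k = n + 4 then A else if k = n + 2 then \<epsilon> else if k = n then C else 0)"
    have sum: "(\<Sum>k\<le>n + 4. smult (h k * c k) (legendre k))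
        = smult (h (n + 4) * A) (legendre (n + 4)) + smult (h (n + 2) * \<epsilon>) (legendre (n + 2)) + smult (h n * C) (legendre n)" for h
    proof -
      have "(\<Sum>k\<le>n + 4. smult (h k * c k) (legendre k)) = (\<Sum>k\<in>{n + 4, n + 2, n}. smult (h k * c k) (legendre k))"
        by (rule sum.mono_neutral_right) (auto simp: c_def)
      then show ?thesis by (simp add: c_def del: legendre.simps)
    qed
    have "[:-s, 1:] * ([:s, 1:] * p) = [:0, 1:] * ([:0, 1:] * p) - smult (s\<^sup>2) p" for p
      by (simp add: poly_eq_poly_eq_iff[symmetric] fun_eq_iff power2_eq_square algebra_simps)
    then have "[:-s, 1:] * ([:s, 1:] * legendre (n + 2)) = [:0, 1:] * ([:0, 1:] * legendre (n + 2)) - smult (s\<^sup>2) (legendre (n + 2))"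
      .
    also have "s\<^sup>2 = B - \<epsilon>"
      using \<epsilon> by (simp add: s_def)
    also have "[:0, 1:] * ([:0, 1:] * legendre (n + 2)) - smult (B - \<epsilon>) (legendre (n + 2))
        = (\<Sum>k\<le>n + 4. smult (1 * c k) (legendre k))"
      unfolding x2 sum by (simp add: smult_diff_left algebra_simps del: legendre.simps)
    finally have "only_real_zeros (\<Sum>k\<le>n + 4. smult (c k) (legendre k))"
      using only_real_zeros_times[OF only_real_zeros_linear[of "-s" 1]
          only_real_zeros_times[OF only_real_zeros_linear[of s 1] only_real_zeros_legendre[of "n + 2"]]]
      by (simp only: mult_1)
    then have "only_real_zeros (\<Sum>k\<le>n + 4. smult (g k * c k) (legendre k))"
      using mult by (simp only: Q_multiplier_sequence_def)
    then have "only_real_zeros (smult (g (n + 2) * \<epsilon>) (legendre (n + 2)) + smult (g n * C) (legendre n))"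
      unfolding sum by (simp add: zero del: legendre.simps)
    then show ?thesis
      using pos \<epsilon> by (intro K) auto
  qed
  have "((\<lambda>\<epsilon>. K * (g (n + 2) * \<epsilon>)) \<longlongrightarrow> K * (g (n + 2) * 0)) (at_right 0)"
    by (intro tendsto_intros)
  moreover have "eventually (\<lambda>\<epsilon>. g n * C \<le> K * (g (n + 2) * \<epsilon>)) (at_right 0)"
    using eventually_at_right_less[of 0] eventually_at_right_real[OF BC(1)]
    by eventually_elim (use small in auto)
  ultimately have "g n * C \<le> K * (g (n + 2) * 0)"
    by (rule tendsto_lowerbound) simp
  then show False
    using mult_pos_pos[OF pos(1) BC(2)] by simp
qed

section \<open>Comparison of the two classes\<close>

text \<open>By parity the factor t^k is the substitution x -> t x, and the constant s only rescales
  the image.\<close>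

lemma Q_multiplier_sequence_sign:
  assumes refl: "\<And>n. pcompose (Q n) [:0, -1:] = smult ((-1) ^ n) (Q n)"
    and mult: "Q_multiplier_sequence Q g" and t: "t = 1 \<or> t = -1"
  shows "Q_multiplier_sequence Q (\<lambda>k. s * t ^ k * g k)"
  unfolding Q_multiplier_sequence_def
proof (intro allI impI)
  fix c n
  assume "only_real_zeros (\<Sum>k\<le>n. smult (c k) (Q k))"
  then have real: "only_real_zeros (\<Sum>k\<le>n. smult (g k * c k) (Q k))"
    using mult by (simp add: Q_multiplier_sequence_def)
  have "(\<Sum>k\<le>n. smult (s * t ^ k * g k * c k) (Q k)) = smult s (pcompose (\<Sum>k\<le>n. smult (g k * c k) (Q k)) [:0, t:])"
  proof -
    have "pcompose (Q k) [:0, t:] = smult (t ^ k) (Q k)" for k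
      using t refl by auto
    then show ?thesis
      by (intro poly_eqI) (simp add: pcompose_sum pcompose_smult coeff_sum sum_distrib_left mult_ac)
  qed
  moreover have "only_real_zeros (smult s (pcompose (\<Sum>k\<le>n. smult (g k * c k) (Q k)) [:0, t:]))"
    using t by (intro only_real_zeros_smult only_real_zeros_pcompose_linear real) auto
  ultimately show "only_real_zeros (\<Sum>k\<le>n. smult (s * t ^ k * g k * c k) (Q k))"
    by simp
qed

lemma hermite_multiplier_two_consecutive:
  assumes "\<And>k. k \<noteq> m \<Longrightarrow> k \<noteq> Suc m \<Longrightarrow> g k = 0"
  shows "Q_multiplier_sequence hermite g"
  unfolding Q_multiplier_sequence_def
proof (intro allI impI)
  fix c n
  define a where "a = (\<lambda>k. if k \<le> n then g k * c k else 0)"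
  have "(\<Sum>k\<le>n. smult (g k * c k) (hermite k)) = (\<Sum>k\<in>{..n} \<union> {m, Suc m}. smult (a k) (hermite k))"
    by (rule sum.mono_neutral_cong_left) (auto simp: a_def)
  also have "\<dots> = (\<Sum>k\<in>{m, Suc m}. smult (a k) (hermite k))"
    by (rule sum.mono_neutral_right) (auto simp: a_def assms)
  also have "\<dots> = smult (a m) (hermite m) + smult (a (Suc m)) (hermite (Suc m))"
    by simp
  finally show "only_real_zeros (\<Sum>k\<le>n. smult (g k * c k) (hermite k))"
    by (simp only: only_real_zeros_hermite_consecutive)
qed

text \<open>From positive values at k, k+1, k+2, the cutoff lemma gives g(k+4) nonzero. The absence
  of gaps then gives g(k+3) nonzero, and its sign agrees with that of g(k+1).\<close>

lemma legendre_multiplier_pos: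
  assumes mult: "Q_multiplier_sequence legendre g" and pos: "g m > 0" "g (Suc m) > 0" "g (m + 2) \<noteq> 0"
  shows "g (m + i) > 0"
proof (induction i rule: less_induct)
  case (less i)
  have "i = 0 \<or> i = 1 \<or> i = 2 \<or> i = (i - 3) + 3"
    by linarith
  then consider "i = 0" | "i = 1" | "i = 2" | j where "i = j + 3"
    by blast
  then show ?case
  proof cases
    case 3
    then show ?thesis
      using legendre_multiplier_step_two_sign[OF mult, of m] pos by (simp add: zero_le_mult_iff)
  next
    case 4
    define k where "k = m + j"
    have k: "g k > 0" "g (k + 1) > 0" "g (k + 2) > 0"
      using less[of j] less[of "j + 1"] less[of "j + 2"] by (simp_all add: 4 k_def)
    have "g (k + 3) \<noteq> 0"
      using legendre_multiplier_no_gap[OF mult, of "k + 2" "k + 4"]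
        legendre_multiplier_no_cutoff[OF mult k(1,3)] k(3) by (auto simp: eval_nat_numeral)
    then show ?thesis
      using legendre_multiplier_step_two_sign[OF mult, of "k + 1"] k(2)
      by (simp add: 4 k_def zero_le_mult_iff eval_nat_numeral)
  qed (use pos in simp_all)
qed

lemma legendre_multiplier_imp_hermite_multiplier:
  assumes mult: "Q_multiplier_sequence legendre g"
  shows "Q_multiplier_sequence hermite g"
proof (cases "\<exists>m. g m \<noteq> 0")
  case False
  then show ?thesis
    by (intro hermite_multiplier_two_consecutive) auto
next
  case True
  define m where "m = (LEAST m. g m \<noteq> 0)"
  have m: "g m \<noteq> 0"
    unfolding m_def using True by (rule LeastI_ex)
  have below: "g k = 0" if "k < m" for k
    using that not_less_Least unfolding m_def by blast
  show ?thesis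
  proof (cases "g (m + 2) = 0")
    case True
    have "g k = 0" if "k > Suc m" for k
    proof (cases "g (Suc m) = 0")
      case True
      then show ?thesis using legendre_multiplier_no_gap[OF mult m] that by simp
    next
      case False
      then show ?thesis using legendre_multiplier_no_gap[OF mult False] True that by simp
    qed
    with below show ?thesis
      by (intro hermite_multiplier_two_consecutive[of m]) (metis linorder_neqE_nat not_less_eq)
  next
    case False
    then have m1: "g (Suc m) \<noteq> 0"
      using legendre_multiplier_no_gap[OF mult m, of "m + 2"] by auto
    \<comment> \<open>The twist by s t^k makes the terms at m and m+1 positive. Since s and t are
      signs, applying it twice recovers \<open>g\<close>.\<close>
    define t where "t = sgn (g m * g (Suc m))"
    define s where "s = sgn (g m) * t ^ m"
    have t: "t = 1 \<or> t = -1"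
      using m m1 by (auto simp: t_def sgn_real_def)
    have tt: "t ^ k * t ^ k = 1" for k
      using t by (auto simp flip: power_mult_distrib)
    have ss: "s * s = 1"
    proof -
      have "s * s = (sgn (g m) * sgn (g m)) * (t ^ m * t ^ m)"
        by (simp add: s_def mult_ac)
      then show ?thesis
        using m by (simp add: tt sgn_real_def)
    qed
    define f where "f = (\<lambda>k. s * t ^ k * g k)"
    have f_mult: "Q_multiplier_sequence legendre f"
      unfolding f_def using legendre_reflect mult t by (rule Q_multiplier_sequence_sign)
    have "f m = sgn (g m) * g m * (t ^ m * t ^ m)" "f (Suc m) = sgn (g m) * t * g (Suc m) * (t ^ m * t ^ m)"
      by (simp_all add: f_def s_def mult_ac)
    then have "f m > 0" "f (Suc m) > 0"
      using m m1 by (auto simp: tt t_def sgn_real_def zero_less_mult_iff mult_less_0_iff split: if_splits)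
    moreover have "f (m + 2) \<noteq> 0"
      using False t ss by (auto simp: f_def)
    ultimately have pos: "f k > 0" if "k \<ge> m" for k
      using legendre_multiplier_pos[OF f_mult, of m "k - m"] that by simp
    have zero: "f k = 0" if "k < m" for k
      using below[OF that] by (simp add: f_def)
    have nonneg: "f k \<ge> 0" for k
      using pos[of k] zero[of k] by (cases "k \<ge> m") auto
    have jr: "jensen_real f"
      using f_mult by (rule legendre_multiplier_jensen_real)
    have "f k \<le> f (Suc k)" for k
    proof (cases "k \<ge> m")
      case True
      show ?thesis
      proof (rule ccontr)
        assume "\<not> f k \<le> f (Suc k)"
        then have less: "f (Suc k) < f k" by simp
        \<comment> \<open>Log-concavity turns one decrease into a second one, against monotonicity
          in steps of two.\<close>
        have "f k * f (k + 2) \<le> f (Suc k) * f (Suc k)"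
          using jensen_real_turan[OF jr, of k] by (simp add: power2_eq_square)
        also have "\<dots> < f k * f (Suc k)"
          using less pos[of "Suc k"] True by simp
        finally have "f (k + 2) < f (Suc k)"
          using pos[OF True] by simp
        moreover have "f k \<le> f (k + 2)"
          using True by (intro legendre_multiplier_step_two_mono[OF f_mult] pos) auto
        ultimately show False
          using less by simp
      qed
    qed (simp add: zero nonneg)
    then have "Q_multiplier_sequence hermite f"
      using hermite_multiplier_of_mono[OF jr nonneg] by (simp add: hermite_poly_eq)
    then have "Q_multiplier_sequence hermite (\<lambda>k. s * t ^ k * f k)"
      using hermite_reflect t by (intro Q_multiplier_sequence_sign)
    also have "(\<lambda>k. s * t ^ k * f k) = g"
    proof
      fix k
      have "s * t ^ k * f k = (s * s) * (t ^ k * t ^ k) * g k"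
        by (simp add: f_def mult_ac)
      then show "s * t ^ k * f k = g k"
        by (simp add: ss tt)
    qed
    finally show ?thesis .
  qed
qed

text \<open>Only the first difference of k at 0 is nonzero, so the Jensen polynomials of the
  differences are the linear polynomials n x.\<close>

lemma hermite_multiplier_linear: "Q_multiplier_sequence hermite_poly real"
proof (rule hermite_multiplier_of_mono)
  define b where "b = (\<lambda>j::nat. if j = 1 then 1 else 0 :: real)"
  have "newton_sum b k = real k" for k
  proof -
    have "newton_sum b k = (\<Sum>j\<le>k. if j = 1 then real (k choose j) else 0)"
      unfolding newton_sum_def by (intro sum.cong) (auto simp: b_def)
    then show ?thesis by (simp add: sum.delta)
  qed
  then have newton: "newton_sum b = real" by auto
  have "only_real_zeros (jensen b n)" for n
  proof -
    have "jensen b n = [:0, real n:]"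
      by (rule poly_eqI) (auto simp: coeff_jensen b_def coeff_pCons split: nat.splits)
    then show ?thesis by simp
  qed
  then show "jensen_real real"
    using jensen_real_newton_sum_iff[of b] by (simp add: newton jensen_real_def)
qed auto

text \<open>The image of \<open>(x + 2)\<^sup>3\<close> is \<open>3x\<^sup>3 + 12x\<^sup>2 + (54/5)x - 4\<close>, with negative discriminant.\<close>

lemma not_legendre_multiplier_linear: "\<not> Q_multiplier_sequence legendre real"
proof
  assume mult: "Q_multiplier_sequence legendre real"
  \<comment> \<open>The coefficients of (x + 2)^3 in the Legendre basis.\<close>
  define c where "c = (\<lambda>k::nat. [10, 63 / 5, 4, 2 / 5 :: real] ! k)"
  have "(\<Sum>k\<le>3. smult (c k) (legendre k)) = [:2, 1:] ^ 3"
    by (simp add: c_def eval_nat_numeral)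
  moreover have "only_real_zeros ([:2, 1:] ^ 3)"
    by (intro only_real_zeros_power only_real_zeros_linear)
  ultimately have "only_real_zeros (\<Sum>k\<le>3. smult (real k * c k) (legendre k))"
    using mult by (simp only: Q_multiplier_sequence_def)
  also have "(\<Sum>k\<le>3. smult (real k * c k) (legendre k)) = [:-4, 3 * (18 / 5), 3 * 4, 3:]"
    by (simp add: c_def eval_nat_numeral)
  finally show False
    using only_real_zeros_cubic[of "-4" "18 / 5" 4 3] by (simp add: power2_eq_square)
qed

theorem theorem3p7:
  shows "(\<forall>\<gamma>. Q_multiplier_sequence legendre_poly \<gamma> \<longrightarrow> Q_multiplier_sequence hermite_poly \<gamma>) \<and>
         (\<exists>\<gamma>. Q_multiplier_sequence hermite_poly \<gamma> \<and> \<not> Q_multiplier_sequence legendre_poly \<gamma>)"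
  using legendre_multiplier_imp_hermite_multiplier hermite_multiplier_linear not_legendre_multiplier_linear
  unfolding legendre_poly_eq hermite_poly_eq by blast

end
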